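(* Let $X\subseteq\mathbb{R}^2$ be a set of $n\geq 2$ points, with first and second convex layers $L_1=L_1(X)$ and $L_2=L_2(X)$. If \[\min\left\{\frac{3}{2}(|L_1|+|L_2|),\ \frac{4}{3}|L_1|+2|L_2|,\ 2|L_1|+|L_2|\right\}\leq n,\] then the second largest distance in $X$ occurs at most $n$ times, i.e. its multiplicity in $X$ is at most $n$.
   Context: For a finite set $X\subseteq\mathbb{R}^2$, the first (outer) convex layer $L_1(X)$ is the set of vertices (extreme points) of the convex hull of $X$. The second convex layer $L_2(X)$ is the set of vertices of the convex hull of $X\setminus L_1(X)$ (empty if $X\setminus L_1(X)$ is empty). The distances determined by $X$ are the distinct values of the Euclidean distance between distinct points of $X$; the second largest distance is the second largest of these distinct values. The multiplicity of a distance $d$ in $X$ is the number of unordered pairs of distinct points of $X$ at distance $d$. *)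

theory Defs
  imports "HOL-Analysis.Analysis"
begin

definition first_layer :: "(real ^ 2) set \<Rightarrow> (real ^ 2) set" where
  "first_layer X = {x. x extreme_point_of (convex hull X)}"

definition second_layer :: "(real ^ 2) set \<Rightarrow> (real ^ 2) set" where
  "second_layer X = first_layer (X - first_layer X)"

definition distances :: "(real ^ 2) set \<Rightarrow> real set" where
  "distances X = {dist x y |x y. x \<in> X \<and> y \<in> X \<and> x \<noteq> y}"

text \<open>A predicate rather than a function: a set determining fewer than two distances
  has no second largest distance. Intended for finite sets only.\<close>

definition is_second_largest_distance :: "(real ^ 2) set \<Rightarrow> real \<Rightarrow> bool" where
  "is_second_largest_distance X d \<longleftrightarrow>
     distances X - {Max (distances X)} \<noteq> {} \<and>
     d = Max (distances X - {Max (distances X)})"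

definition multiplicity_of_distance :: "(real ^ 2) set \<Rightarrow> real \<Rightarrow> nat" where
  "multiplicity_of_distance X d =
     card {{x, y} |x y. x \<in> X \<and> y \<in> X \<and> x \<noteq> y \<and> dist x y = d}"

end

theory Submission
  imports Defs
begin

text \<open>Let D be the largest and d the second largest distance, and call pairs at distance d edges.
  A point that is not extreme has an extreme point farther away from any given point; hence every
  edge lies in the first two layers and touches the first one. The hypothesis leaves a point w
  outside the two layers, at distance less than d from all points, so that the neighbours of a
  vertex lie in an open half-plane and are linearly ordered by angle. If x y is rightmost at neither
  of its ends, then there is a zigzag x', y, x, y' of edges whose ends are at distance D, and this
  forces x y to be second from the right at both ends. Such edges therefore form a matching M, and
  there are at most |V| + |M| edges. The bounds |M| \<le> |V| / 2 and |M| \<le> |L1| give the first and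
  the third term of the minimum. For points in convex position, inequalities in quadrilaterals and
  the exclusion of one isosceles trapezoid show that the rightmost neighbours of the vertices covered
  by M are distinct and that each edge of M has an end whose rightmost neighbour is not covered,
  so |M| \<le> |V| / 3. Together with degree at most 2 outside L1 this gives the second term.\<close>

section \<open>Edges that are rightmost at neither end\<close>

text \<open>R x a b means that a lies to the right of b when seen from x.\<close>

locale right_order =
  fixes V :: "'a set" and adj :: "'a \<Rightarrow> 'a \<Rightarrow> bool" and R :: "'a \<Rightarrow> 'a \<Rightarrow> 'a \<Rightarrow> bool"
  assumes finite_V: "finite V"
    and adj_in: "adj x y \<Longrightarrow> x \<in> V"
    and adj_sym: "adj x y \<Longrightarrow> adj y x"
    and R_asym: "adj x a \<Longrightarrow> adj x b \<Longrightarrow> R x a b \<Longrightarrow> \<not> R x b a"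
    and R_total: "adj x a \<Longrightarrow> adj x b \<Longrightarrow> a \<noteq> b \<Longrightarrow> R x a b \<or> R x b a"
    and R_trans: "adj x a \<Longrightarrow> adj x b \<Longrightarrow> adj x c \<Longrightarrow> R x a b \<Longrightarrow> R x b c \<Longrightarrow> R x a c"
    and R_unique: "adj x y \<Longrightarrow> adj x a \<Longrightarrow> adj x b \<Longrightarrow> adj y c \<Longrightarrow>
      R x a y \<Longrightarrow> R x b y \<Longrightarrow> R y c x \<Longrightarrow> a = b"
begin

definition rightmost :: "'a \<Rightarrow> 'a \<Rightarrow> bool" where
  "rightmost x y \<longleftrightarrow> adj x y \<and> (\<forall>a. adj x a \<longrightarrow> \<not> R x a y)"

text \<open>As a relation it lists every edge of the matching M in both directions.\<close>

definition inner_edge :: "'a \<Rightarrow> 'a \<Rightarrow> bool" where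
  "inner_edge x y \<longleftrightarrow> adj x y \<and> \<not> rightmost x y \<and> \<not> rightmost y x"

lemma adj_in2: "adj x y \<Longrightarrow> y \<in> V"
  using adj_in adj_sym by blast

lemma inner_edge_sym: "inner_edge x y \<Longrightarrow> inner_edge y x"
  by (auto simp: inner_edge_def adj_sym)

lemma rightmost_unique: "rightmost x y \<Longrightarrow> rightmost x z \<Longrightarrow> y = z"
  unfolding rightmost_def using R_total by blast

lemma ex_rightmost:
  assumes "adj x y" shows "\<exists>z. rightmost x z"
proof -
  let ?N = "{z. adj x z}"
  have fin: "finite ?N"
    by (rule finite_subset[OF _ finite_V]) (auto simp: adj_in2)
  \<comment> \<open>The rank \<open>r a\<close> counts the neighbours further right. Transitivity
    makes it strictly monotone, so a neighbour of least rank is rightmost.\<close>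
  define r where "r a = card {b \<in> ?N. R x b a}" for a
  have less: "r a < r b" if "a \<in> ?N" "b \<in> ?N" "R x a b" for a b
    unfolding r_def
  proof (rule psubset_card_mono)
    show "finite {c \<in> ?N. R x c b}" using fin by simp
    show "{c \<in> ?N. R x c a} \<subset> {c \<in> ?N. R x c b}"
      using that R_trans R_asym by blast
  qed
  obtain z where z: "z \<in> ?N" "\<And>c. c \<in> ?N \<Longrightarrow> r z \<le> r c"
    using ex_has_least_nat[of "\<lambda>c. c \<in> ?N" y r] assms by auto
  have "rightmost x z"
    unfolding rightmost_def
  proof (intro conjI allI impI notI)
    show "adj x z" using z by simp
    fix a assume "adj x a" "R x a z"
    then show False using less[of a z] z(1) z(2)[of a] by simp
  qed
  then show ?thesis ..
qed

text \<open>Turns the two negations into the zigzag \<open>a\<close>, \<open>x\<close>,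
  \<open>y\<close>, \<open>b\<close> around the edge, the form in which later arguments use
  it.\<close>

lemma inner_edgeE:
  assumes "inner_edge x y"
  obtains a b where "rightmost x a" "rightmost y b" "adj x a" "adj y b" "adj x y" "R x a y" "R y b x"
proof -
  have adj: "adj x y" "adj y x" using assms adj_sym by (auto simp: inner_edge_def)
  obtain a b where ab: "rightmost x a" "rightmost y b" using adj ex_rightmost by blast
  have "R x a y" using ab(1) assms adj R_total[of x a y] by (auto simp: rightmost_def inner_edge_def)
  moreover have "R y b x" using ab(2) assms adj R_total[of y b x] by (auto simp: rightmost_def inner_edge_def)
  ultimately show thesis using ab adj that by (auto simp: rightmost_def)
qed

text \<open>If \<open>y\<close> were right of \<open>z\<close>, then \<open>y\<close> and some
  neighbour \<open>a\<close> right of \<open>y\<close> would both be right of \<open>z\<close>, and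
  \<open>R_unique\<close> at the edge \<open>x z\<close> would identify them.\<close>

lemma inner_edge_unique:
  assumes "inner_edge x y" "inner_edge x z" shows "y = z"
proof -
  have *: "\<not> R x y z" if xy: "inner_edge x y" and xz: "inner_edge x z" for y z
  proof
    assume yz: "R x y z"
    obtain a where a: "adj x a" "R x a y" using inner_edgeE[OF xy] by metis
    obtain c where c: "adj z c" "R z c x" using inner_edgeE[OF xz] by metis
    have adj: "adj x y" "adj x z" using xy xz by (auto simp: inner_edge_def)
    have "R x a z" using R_trans a adj yz by blast
    then have "a = y" using R_unique[of x z a y c] adj a c yz by blast
    then show False using a adj R_asym by blast
  qed
  show ?thesis
    using *[OF assms] *[OF assms(2,1)] assms R_total[of x y z] by (auto simp: inner_edge_def)
qed

section \<open>Counting edges by rightmost neighbours\<close>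

definition covered :: "'a set" where
  "covered = {x. \<exists>y. inner_edge x y}"

lemma covered_subset: "covered \<subseteq> V"
  by (auto simp: covered_def inner_edge_def adj_in)

lemma finite_covered: "finite covered"
  using covered_subset finite_V finite_subset by blast

lemma finite_adj: "finite {(x, y). adj x y}"
  by (rule finite_subset[of _ "V \<times> V"]) (auto simp: finite_V adj_in adj_in2)

text \<open>Ordered pairs are counted, so bounds on edges appear doubled. An edge that is not inner
  is rightmost at one of its ends, and each vertex has at most one rightmost neighbour.\<close>

lemma card_adj_le: "card {(x, y). adj x y} \<le> 2 * card V + card {(x, y). inner_edge x y}"
proof -
  let ?A = "{(x, y). rightmost x y}"
  have fin: "finite ?A" "finite {(x, y). inner_edge x y}"
    by (rule finite_subset[OF _ finite_adj], auto simp: rightmost_def inner_edge_def)+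
  have "inj_on fst ?A" by (auto simp: inj_on_def dest: rightmost_unique)
  moreover have "fst ` ?A \<subseteq> V" by (auto simp: rightmost_def adj_in)
  ultimately have A: "card ?A \<le> card V" by (rule card_inj_on_le[OF _ _ finite_V])
  have "card {(x, y). adj x y} \<le> card (?A \<union> prod.swap ` ?A \<union> {(x, y). inner_edge x y})"
    by (rule card_mono) (use fin in \<open>auto simp: inner_edge_def image_iff\<close>)
  also have "\<dots> \<le> card ?A + card (prod.swap ` ?A) + card {(x, y). inner_edge x y}"
    by (meson card_Un_le add_le_mono1 le_trans)
  also have "\<dots> \<le> 2 * card V + card {(x, y). inner_edge x y}"
    using A card_image_le[OF fin(1), of prod.swap] by linarith
  finally show ?thesis .
qed

lemma inj_fst_inner: "inj_on fst {(x, y). inner_edge x y}"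
  by (auto simp: inj_on_def dest: inner_edge_unique)

lemma card_inner_edges: "card {(x, y). inner_edge x y} = card covered"
proof -
  have "fst ` {(x, y). inner_edge x y} = covered" by (force simp: covered_def)
  then show ?thesis using card_image[OF inj_fst_inner] by simp
qed

lemma card_adj_le_3: "card {(x, y). adj x y} \<le> 3 * card V"
  using card_adj_le card_mono[OF finite_V covered_subset] by (simp add: card_inner_edges)

text \<open>Every inner edge has an end in \<open>A\<close>, and different edges of a matching have
  different ends, so at most |A| inner edges exist, each counted in both directions.\<close>

lemma card_adj_le_vertex_cover:
  assumes A: "A \<subseteq> V" and cover: "\<And>x y. adj x y \<Longrightarrow> x \<in> A \<or> y \<in> A"
  shows "card {(x, y). adj x y} \<le> 2 * card V + 2 * card A"
proof -
  have finA: "finite A" using A finite_V finite_subset by blast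
  let ?B = "{(x, y). inner_edge x y \<and> x \<in> A}"
  have fin: "finite ?B"
    by (rule finite_subset[OF _ finite_adj]) (auto simp: inner_edge_def)
  have "inj_on fst ?B" by (rule inj_on_subset[OF inj_fst_inner]) auto
  then have B: "card ?B \<le> card A"
    by (rule card_inj_on_le) (use finA in auto)
  have "{(x, y). inner_edge x y} \<subseteq> ?B \<union> prod.swap ` ?B"
  proof
    fix e assume "e \<in> {(x, y). inner_edge x y}"
    then obtain x y where e: "e = (x, y)" "inner_edge x y" by auto
    then have "e \<in> ?B \<or> (y, x) \<in> ?B" using cover[of x y] inner_edge_sym by (auto simp: inner_edge_def)
    then show "e \<in> ?B \<union> prod.swap ` ?B" using e(1) by (auto intro: image_eqI[of _ _ "(y, x)"])
  qed
  then have "card {(x, y). inner_edge x y} \<le> card (?B \<union> prod.swap ` ?B)"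
    using fin by (intro card_mono) auto
  also have "\<dots> \<le> card ?B + card (prod.swap ` ?B)" by (rule card_Un_le)
  also have "\<dots> \<le> 2 * card A" using B card_image_le[OF fin, of prod.swap] by linarith
  finally show ?thesis using card_adj_le by linarith
qed

end

section \<open>Points in convex position\<close>

text \<open>The edges and the diameters of a set in convex position, reduced to its cyclic order:
  in a convex quadrilateral the diagonals are together longer than two opposite sides.\<close>

locale convex_distance_graph = right_order V adj cyc
  for V :: "'a set" and adj :: "'a \<Rightarrow> 'a \<Rightarrow> bool" and cyc :: "'a \<Rightarrow> 'a \<Rightarrow> 'a \<Rightarrow> bool" +
  fixes diam :: "'a \<Rightarrow> 'a \<Rightarrow> bool"
  assumes diam_in: "diam x y \<Longrightarrow> x \<in> V"
    and diam_sym: "diam x y \<Longrightarrow> diam y x"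
    and diam_irrefl: "\<not> diam x x"
    and adj_not_diam: "adj x y \<Longrightarrow> \<not> diam x y"
    and cyc_rotate: "cyc a b c \<Longrightarrow> cyc b c a"
    and cyc_asym: "cyc a b c \<Longrightarrow> \<not> cyc a c b"
    and cyc_total: "a \<in> V \<Longrightarrow> b \<in> V \<Longrightarrow> c \<in> V \<Longrightarrow> a \<noteq> b \<Longrightarrow> a \<noteq> c \<Longrightarrow> b \<noteq> c \<Longrightarrow> cyc a b c \<or> cyc a c b"
    and cyc_trans: "a \<in> V \<Longrightarrow> b \<in> V \<Longrightarrow> c \<in> V \<Longrightarrow> e \<in> V \<Longrightarrow> cyc a b c \<Longrightarrow> cyc a c e \<Longrightarrow> cyc a b e"
    and quad_adj_adj: "cyc a b c \<Longrightarrow> cyc a c e \<Longrightarrow> adj a b \<Longrightarrow> adj c e \<Longrightarrow> diam a c \<or> diam b e"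
    and quad_diam_adj: "cyc a b c \<Longrightarrow> cyc a c e \<Longrightarrow> diam a b \<Longrightarrow> adj c e \<Longrightarrow> diam a c \<and> diam b e"
    and quad_diam_diam: "cyc a b c \<Longrightarrow> cyc a c e \<Longrightarrow> diam a b \<Longrightarrow> \<not> diam c e"
    and no_trapezoid: "cyc p a q \<Longrightarrow> cyc p q r \<Longrightarrow> cyc p r b \<Longrightarrow> cyc p b s \<Longrightarrow>
      adj p s \<Longrightarrow> adj q r \<Longrightarrow> diam p r \<Longrightarrow> diam q s \<Longrightarrow>
      adj a r \<Longrightarrow> adj a s \<Longrightarrow> adj b p \<Longrightarrow> \<not> adj b q"
begin

section \<open>Numbering the cyclic order\<close>

lemma cyc_distinct: "cyc a b c \<Longrightarrow> a \<noteq> b \<and> b \<noteq> c \<and> a \<noteq> c"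
  using cyc_rotate cyc_asym by metis

text \<open>The disjunction is the cyclic order of the natural numbers: one of the three rotations
  of the triple increases.\<close>

definition index_from :: "'a \<Rightarrow> ('a \<Rightarrow> nat) \<Rightarrow> bool" where
  "index_from p f \<longleftrightarrow> inj_on f V \<and> (\<forall>a\<in>V. f p \<le> f a) \<and>
    (\<forall>a\<in>V. \<forall>b\<in>V. \<forall>c\<in>V. cyc a b c \<longleftrightarrow>
      f a < f b \<and> f b < f c \<or> f b < f c \<and> f c < f a \<or> f c < f a \<and> f a < f b)"

text \<open>Cutting the cyclic order at p turns every statement about it into linear arithmetic.\<close>

lemma ex_index_from:
  assumes p: "p \<in> V"
  shows "\<exists>f. index_from p f"
proof -
  \<comment> \<open>\<open>L\<close> is the order in which the points are met when starting from
    \<open>p\<close>; \<open>f\<close> counts predecessors.\<close>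
  define L where "L a b \<longleftrightarrow> a = p \<and> b \<noteq> p \<or> cyc p a b" for a b
  define f where "f a = card {b \<in> V. L b a}" for a
  have L_trans: "L a c" if "a \<in> V" "b \<in> V" "c \<in> V" "L a b" "L b c" for a b c
    using that cyc_trans[of p a b c] cyc_distinct p unfolding L_def by blast
  have L_irrefl: "\<not> L a a" for a using cyc_distinct unfolding L_def by blast
  have L_total: "L a b \<or> L b a" if "a \<in> V" "b \<in> V" "a \<noteq> b" for a b
    using that cyc_total[of p a b] p unfolding L_def by blast
  have f_less: "f a < f b" if "a \<in> V" "b \<in> V" "L a b" for a b
    unfolding f_def
  proof (rule psubset_card_mono)
    show "finite {c \<in> V. L c b}" using finite_V by simp
    show "{c \<in> V. L c a} \<subset> {c \<in> V. L c b}" using that L_trans L_irrefl by blast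
  qed
  have less_iff: "f a < f b \<longleftrightarrow> L a b" if "a \<in> V" "b \<in> V" for a b
    using f_less[OF that] f_less[OF that(2,1)] L_total[OF that] by fastforce
  have f_inj: "a = b" if "a \<in> V" "b \<in> V" "f a = f b" for a b
    using L_total[of a b] less_iff[of a b] less_iff[of b a] that by auto
  have cyc_L: "cyc a b c" if "a \<in> V" "b \<in> V" "c \<in> V" "L a b" "L b c" for a b c
  proof (cases "a = p")
    case True
    then show ?thesis using that L_trans L_irrefl unfolding L_def by blast
  next
    case False
    then have "cyc p a b" "cyc p b c" using that cyc_distinct unfolding L_def by blast+
    \<comment> \<open>Seen from \<open>b\<close> the order is \<open>c\<close>, \<open>p\<close>,
      \<open>a\<close>, so \<open>cyc_trans\<close> can drop \<open>p\<close>.\<close>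
    then have "cyc b c p" "cyc b p a" using cyc_rotate by blast+
    then have "cyc b c a" using cyc_trans that p by blast
    then show ?thesis using cyc_rotate by blast
  qed
  have "index_from p f"
    unfolding index_from_def
  proof (intro conjI ballI)
    show "inj_on f V" by (rule inj_onI) (rule f_inj)
  next
    fix a assume "a \<in> V"
    then show "f p \<le> f a" using less_iff[of p a] p by (cases "a = p") (auto simp: L_def)
  next
    fix a b c assume V: "a \<in> V" "b \<in> V" "c \<in> V"
    show "cyc a b c \<longleftrightarrow>
      f a < f b \<and> f b < f c \<or> f b < f c \<and> f c < f a \<or> f c < f a \<and> f a < f b" (is "_ \<longleftrightarrow> ?F a b c")
    proof
      have F: "cyc a b c" if "a \<in> V" "b \<in> V" "c \<in> V" "?F a b c" for a b c
        using that(4)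
      proof (elim disjE)
        assume "f a < f b \<and> f b < f c"
        then show ?thesis using cyc_L that(1-3) less_iff by blast
      next
        assume "f b < f c \<and> f c < f a"
        then have "cyc b c a" using cyc_L that(1-3) less_iff by blast
        then show ?thesis using cyc_rotate by blast
      next
        assume "f c < f a \<and> f a < f b"
        then have "cyc c a b" using cyc_L that(1-3) less_iff by blast
        then show ?thesis using cyc_rotate by blast
      qed
      show "?F a b c \<Longrightarrow> cyc a b c" using F[OF V] .
      assume abc: "cyc a b c"
      then have "\<not> ?F a c b" using F[of a c b] V cyc_asym by blast
      moreover have "f a \<noteq> f b" "f a \<noteq> f c" "f b \<noteq> f c"
        using cyc_distinct[OF abc] f_inj V by blast+
      ultimately show "?F a b c" by linarith
    qed
  qed
  then show ?thesis by blast
qed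

lemma index_from_less: "index_from p f \<Longrightarrow> a \<in> V \<Longrightarrow> p \<in> V \<Longrightarrow> a \<noteq> p \<Longrightarrow> f p < f a"
  unfolding index_from_def by (metis inj_onD le_neq_implies_less)

lemma index_from_inj: "index_from p f \<Longrightarrow> a \<in> V \<Longrightarrow> b \<in> V \<Longrightarrow> f a = f b \<longleftrightarrow> a = b"
  unfolding index_from_def by (metis inj_onD)

lemma index_from_cyc: "index_from p f \<Longrightarrow> a \<in> V \<Longrightarrow> b \<in> V \<Longrightarrow> c \<in> V \<Longrightarrow> cyc a b c \<longleftrightarrow>
    f a < f b \<and> f b < f c \<or> f b < f c \<and> f c < f a \<or> f c < f a \<and> f a < f b"
  unfolding index_from_def by blast

lemma index_from_less_cyc:
  "index_from p f \<Longrightarrow> cyc p a b \<Longrightarrow> p \<in> V \<Longrightarrow> a \<in> V \<Longrightarrow> b \<in> V \<Longrightarrow> f p < f a \<and> f a < f b"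
  using index_from_cyc[of p f p a b] index_from_less[of p f a] cyc_distinct[of p a b]
    index_from_less[of p f b] by fastforce

text \<open>The diagonals are \<open>a c\<close> and \<open>b e\<close>. The eight rules are the
  three assumptions on quadrilaterals, read from each of the four vertices in turn.\<close>

lemma quadrilateral:
  assumes f: "index_from p f" and V: "a \<in> V" "b \<in> V" "c \<in> V" "e \<in> V"
    and less: "f a < f b" "f b < f c" "f c < f e"
  shows "adj a b \<Longrightarrow> adj c e \<Longrightarrow> diam a c \<or> diam b e"
    and "adj b c \<Longrightarrow> adj a e \<Longrightarrow> diam a c \<or> diam b e"
    and "diam a b \<Longrightarrow> adj c e \<Longrightarrow> diam a c \<and> diam b e"
    and "diam b c \<Longrightarrow> adj a e \<Longrightarrow> diam a c \<and> diam b e"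
    and "adj a b \<Longrightarrow> diam c e \<Longrightarrow> diam a c \<and> diam b e"
    and "adj b c \<Longrightarrow> diam a e \<Longrightarrow> diam a c \<and> diam b e"
    and "diam a b \<Longrightarrow> \<not> diam c e"
    and "diam b c \<Longrightarrow> \<not> diam a e"
proof -
  have c: "cyc a b c" "cyc a c e" "cyc b c e" "cyc b e a" "cyc c e a" "cyc c a b" "cyc e a b" "cyc e b c"
    using index_from_cyc[OF f] V less by auto
  show "adj a b \<Longrightarrow> adj c e \<Longrightarrow> diam a c \<or> diam b e"
    using quad_adj_adj c(1,2) by blast
  show "adj b c \<Longrightarrow> adj a e \<Longrightarrow> diam a c \<or> diam b e"
    using quad_adj_adj[of b c e a] c(3,4) adj_sym diam_sym by blast
  show "diam a b \<Longrightarrow> adj c e \<Longrightarrow> diam a c \<and> diam b e"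
    using quad_diam_adj c(1,2) by blast
  show "diam b c \<Longrightarrow> adj a e \<Longrightarrow> diam a c \<and> diam b e"
    using quad_diam_adj[of b c e a] c(3,4) adj_sym diam_sym by blast
  show "adj a b \<Longrightarrow> diam c e \<Longrightarrow> diam a c \<and> diam b e"
    using quad_diam_adj[of c e a b] c(5,6) adj_sym diam_sym by blast
  show "adj b c \<Longrightarrow> diam a e \<Longrightarrow> diam a c \<and> diam b e"
    using quad_diam_adj[of e a b c] c(7,8) adj_sym diam_sym by blast
  show "diam a b \<Longrightarrow> \<not> diam c e"
    using quad_diam_diam c(1,2) by blast
  show "diam b c \<Longrightarrow> \<not> diam a e"
    using quad_diam_diam[of b c e a] c(3,4) diam_sym by blast
qed

text \<open>In the quadrilateral \<open>x\<close>, \<open>a\<close>, \<open>y\<close>,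
  \<open>b\<close> two opposite sides and the diagonal \<open>x y\<close> are edges, which forces
  the other diagonal to be a diameter.\<close>

lemma inner_edge_targets_diam:
  assumes "inner_edge x y" "rightmost x a" "rightmost y b"
  shows "diam a b"
proof -
  have *: "adj x a" "adj y b" "adj x y" "cyc x a y" "cyc y b x"
    using assms by (metis inner_edgeE rightmost_unique)+
  then have "cyc x y b" by (blast intro: cyc_rotate)
  then show ?thesis using quad_adj_adj[of x a y b] * adj_not_diam by blast
qed

text \<open>Let \<open>s\<close> and \<open>s'\<close> be the rightmost neighbours of
  \<open>x\<close> and \<open>x'\<close>. Comparing positions after \<open>t\<close> forces
  \<open>s' = s\<close> and leaves only the forbidden trapezoid.\<close>

lemma inner_edges_share_target_aux:
  assumes xy: "inner_edge x y" "rightmost y t"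
    and xy': "inner_edge x' y'" "rightmost y' t"
    and c: "cyc t y' y"
  shows False
proof -
  obtain s where s: "adj x s" "adj y t" "adj x y" "cyc x s y" "cyc y t x" "rightmost x s"
    using inner_edgeE[OF xy(1)] xy(2) rightmost_unique by metis
  obtain s' where s': "adj x' s'" "adj y' t" "adj x' y'" "cyc x' s' y'" "cyc y' t x'" "rightmost x' s'"
    using inner_edgeE[OF xy'(1)] xy'(2) rightmost_unique by metis
  have V: "x \<in> V" "y \<in> V" "t \<in> V" "s \<in> V" "x' \<in> V" "y' \<in> V" "s' \<in> V"
    using s s' adj_in adj_in2 by blast+
  obtain f where f: "index_from t f" using ex_index_from V(3) by blast
  note less = index_from_less_cyc[OF f _ V(3)] and Q = quadrilateral[OF f]
  note sym = adj_sym[of x y] adj_sym[of x s] adj_sym[of y t] adj_sym[of x' y'] adj_sym[of x' s'] adj_sym[of y' t]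
  have ts: "diam t s" "diam t s'"
    using inner_edge_targets_diam xy xy' s(6) s'(6) diam_sym by blast+
  have xy_less: "f t < f x" "f x < f y" using less[of x y] s(5) cyc_rotate V by blast+
  have x'y'_less: "f t < f x'" "f x' < f y'" using less[of x' y'] s'(5) cyc_rotate V by blast+
  have y'y: "f y' < f y" using less[of y' y] c V by blast
  have sy: "f x < f s" "f s < f y"
    using s(4) index_from_cyc[OF f V(1,4,2)] xy_less by linarith+
  have s'y': "f x' < f s'" "f s' < f y'"
    using s'(4) index_from_cyc[OF f V(5,7,6)] x'y'_less by linarith+
  note ord = xy_less x'y'_less y'y sy s'y'
  \<comment> \<open>The sides \<open>t y\<close> and \<open>x' y'\<close> are edges and so is the
    diagonal \<open>t y'\<close>; hence the other diagonal is a diameter.\<close>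
  have x'y: "diam x' y"
    using Q(2)[of t x' y' y] s s' adj_not_diam sym ord V by auto
  \<comment> \<open>Beyond \<open>s\<close>, the point \<open>x'\<close> would make
    \<open>x' y\<close> a diameter opposite to the diameter \<open>t s\<close>; before
    \<open>x\<close>, it would turn the edge \<open>x y\<close> into a diameter.\<close>
  have "\<not> f s < f x'"
    using Q(7)[of t s x' y] ts x'y ord V by auto
  moreover have "\<not> f x' < f x"
    using Q(6)[of x' x s y] x'y s adj_not_diam ord V by auto
  moreover have "f x' \<noteq> f x" using index_from_inj[OF f] x'y s adj_not_diam V by blast
  ultimately have x': "f x < f x'" "f x' \<le> f s" by linarith+
  \<comment> \<open>Either strict inequality between \<open>s\<close> and \<open>s'\<close> turns an
    edge into a diameter.\<close>
  have "\<not> f s' < f s"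
  proof
    assume less: "f s' < f s"
    have x's: "diam x' s"
      using Q(6)[of t x' s' s] ts s' less ord V by auto
    have "f y' \<noteq> f s" using index_from_inj[OF f] x's adj_not_diam s' V by blast
    moreover have "\<not> f s < f y'"
      using Q(4)[of t x' s y'] x's s' sym adj_not_diam less ord V by auto
    moreover have "\<not> f y' < f s"
      using Q(6)[of t x' y' s] ts s' sym adj_not_diam less ord V by auto
    ultimately show False by linarith
  qed
  moreover have "\<not> f s < f s'"
  proof
    assume less: "f s < f s'"
    have "diam x s'"
      using Q(6)[of t x s s'] ts s less ord V by auto
    then show False
      using Q(4)[of t x s' y] s sym adj_not_diam less ord V by auto
  qed
  ultimately have eq: "s' = s" using index_from_inj[OF f V(7,4)] by linarith
  have "f x' < f s" using s'y' eq by simp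
  then have "cyc t x x'" "cyc t x' s" "cyc t s y'" "cyc t y' y"
    using index_from_cyc[OF f] ord x' V eq by auto
  \<comment> \<open>The trapezoid is \<open>t\<close>, \<open>x'\<close>, \<open>s\<close>,
    \<open>y\<close>, with apex \<open>x\<close> beyond \<open>t x'\<close> and apex
    \<open>y'\<close> beyond \<open>s y\<close>.\<close>
  then show False
    using no_trapezoid[OF _ _ _ _ s(2)[THEN adj_sym] s'(1)[unfolded eq] ts(1) x'y s(1) s(3) s'(2)]
      adj_sym[OF s'(3)] by blast
qed

lemma inner_edges_share_target:
  assumes "inner_edge x y" "rightmost y t" "inner_edge x' y'" "rightmost y' t"
  shows "y' = y"
proof (rule ccontr)
  assume "y' \<noteq> y"
  then have "cyc t y' y \<or> cyc t y y'"
    using R_total[of t y' y] assms adj_sym by (auto simp: rightmost_def)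
  then show False using inner_edges_share_target_aux assms by blast
qed

text \<open>Locates the zigzag \<open>z1\<close>, \<open>q\<close>, \<open>z\<close>,
  \<open>w\<close> relative to a diameter \<open>p q\<close>. If \<open>z\<close> came before
  \<open>q\<close>, the edge \<open>q z\<close> would become a diameter. The quadrilateral
  \<open>z\<close>, \<open>w\<close>, \<open>q\<close>, \<open>z1\<close> has this edge as a
  diagonal, so \<open>z1 w\<close> is a diameter, and it cannot be opposite to
  \<open>p q\<close>.\<close>

lemma target_inner_edge:
  assumes pq: "diam p q" and qz: "adj q z" "adj q z1" "adj z w" "cyc q z1 z" "cyc z w q"
  shows "cyc p q z1 \<and> cyc p z1 z \<and> diam z1 w \<and> (w = p \<or> cyc p w q)"
proof -
  have V: "p \<in> V" "q \<in> V" "z \<in> V" "z1 \<in> V" "w \<in> V"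
    using diam_in[OF pq] adj_in[OF qz(1)] adj_in[OF qz(3)] adj_in2[OF qz(2)] adj_in2[OF qz(3)] by auto
  obtain f where f: "index_from p f" using ex_index_from V(1) by blast
  note Q = quadrilateral[OF f]
  have qp: "q \<noteq> p" "z \<noteq> p" "z1 \<noteq> p" using qz pq diam_irrefl diam_sym adj_not_diam by blast+
  have pos: "f p < f z" "f p < f z1" "f p < f q" using index_from_less[OF f] V qp by blast+
  have zq: "f z \<noteq> f q" using cyc_distinct[OF qz(4)] index_from_inj[OF f] V by auto
  have cyc_z: "f z < f w \<and> f w < f q \<or> f w < f q \<and> f q < f z \<or> f q < f z \<and> f z < f w"
    using index_from_cyc[OF f V(3,5,2)] qz(5) by simp
  have "\<not> f z < f q"
    using Q(6)[of p z w q] adj_sym[OF qz(1)] qz(3) pq adj_not_diam pos V cyc_z by auto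
  then have ord: "f q < f z1" "f z1 < f z"
    using index_from_cyc[OF f V(2,4,3)] qz(4) zq by linarith+
  have "cyc z w q" "cyc z q z1" using index_from_cyc[OF f] qz(5) ord V by auto
  then have z1w: "diam z1 w"
    using quad_adj_adj[of z w q z1] qz adj_sym diam_sym adj_not_diam by blast
  have "\<not> f z < f w"
    using Q(7)[of p q z1 w] pq z1w ord pos V by auto
  then have "w = p \<or> f p < f w \<and> f w < f q"
    using cyc_z index_from_less[OF f, of w] ord V by linarith
  then show ?thesis using index_from_cyc[OF f] z1w ord pos V by auto
qed

text \<open>The targets form a diameter \<open>p q\<close>. Applying
  \<open>target_inner_edge\<close> at both ends yields diameters \<open>z1 w\<close> and
  \<open>v1 u\<close>; these are forced to coincide, and then the forbidden trapezoid
  appears.\<close>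

lemma not_both_targets_covered:
  assumes "inner_edge x y" "rightmost x q" "rightmost y p" "inner_edge q z" "inner_edge p v"
  shows False
proof -
  have pq: "diam p q" "diam q p" using assms inner_edge_targets_diam diam_sym by blast+
  obtain z1 w where z: "adj q z" "adj q z1" "adj z w" "cyc q z1 z" "cyc z w q"
    using inner_edgeE[OF assms(4)] by metis
  obtain v1 u where v: "adj p v" "adj p v1" "adj v u" "cyc p v1 v" "cyc v u p"
    using inner_edgeE[OF assms(5)] by metis
  have V: "p \<in> V" "q \<in> V" "z \<in> V" "z1 \<in> V" "w \<in> V" "v \<in> V" "v1 \<in> V" "u \<in> V"
    using adj_in[OF v(1)] adj_in[OF z(1)] adj_in[OF z(3)] adj_in2[OF z(2)] adj_in2[OF z(3)]
      adj_in[OF v(3)] adj_in2[OF v(2)] adj_in2[OF v(3)] by auto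
  obtain f where f: "index_from p f" using ex_index_from V(1) by blast
  note less = index_from_less_cyc[OF f _ V(1)] and Q = quadrilateral[OF f]
  note sym = adj_sym[of q z] adj_sym[of q z1] adj_sym[of z w] adj_sym[of p v] adj_sym[of p v1] adj_sym[of v u]
  note tz = target_inner_edge[OF pq(1) z] and tv = target_inner_edge[OF pq(2) v]
  have D: "diam z1 w" "diam v1 u" "diam w z1" "diam u v1" using tz tv diam_sym by blast+
  have "cyc p v1 q" "cyc p v1 v" "cyc p v q"
    using tv cyc_rotate cyc_trans[OF V(2,1) V(7,6)] cyc_trans V by meson+
  then have ord: "f p < f v1" "f v1 < f v" "f v < f q" "f q < f z1" "f z1 < f z"
    using less tz V by blast+
  have uq: "f q \<le> f u" using tv less[of q u] cyc_rotate V by fastforce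
  have wq: "f p \<le> f w \<and> f w < f q" using tz less[of w q] ord V by fastforce
  \<comment> \<open>Otherwise \<open>v1 u\<close> and the edge \<open>q z1\<close> give the diameter
    \<open>q u\<close>, which with the edge \<open>p v\<close> turns the edge \<open>v u\<close>
    into a diameter. The bound on \<open>w\<close> is the mirror image.\<close>
  have "\<not> f z1 < f u"
  proof
    assume less: "f z1 < f u"
    have "diam q u" using Q(6)[of v1 q z1 u] D z less ord V by auto
    then show False
      using Q(5)[of p v q u] v sym adj_not_diam[of v u] less ord V by auto
  qed
  then have uz: "f u \<le> f z1" by simp
  have "\<not> f v1 < f w"
  proof
    assume less: "f v1 < f w"
    have "diam p w" using Q(5)[of p v1 w z1] D v less wq ord V by auto
    then show False
      using Q(3)[of p w q z] z sym adj_not_diam[of w z] less wq ord V by auto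
  qed
  then have wv: "f w \<le> f v1" by simp
  \<comment> \<open>With both bounds strict the two diameters are opposite sides; with exactly one
    strict an edge becomes a diameter.\<close>
  have "\<not> (f w < f v1 \<and> f u < f z1)"
    using Q(8)[of w v1 u z1] D uq wq ord V by auto
  moreover have "\<not> (w = v1 \<and> f u < f z1)"
  proof
    assume *: "w = v1 \<and> f u < f z1"
    have "diam v z1"
      using Q(6)[of v1 v u z1] D v * uq ord V by auto
    then show False
      using Q(5)[of p v1 v z1] v adj_not_diam[of p v] ord V by auto
  qed
  moreover have "\<not> (f w < f v1 \<and> u = z1)"
  proof
    assume *: "f w < f v1 \<and> u = z1"
    have "diam v1 z"
      using Q(4)[of w v1 z1 z] D z * wq ord sym V by auto
    then show False
      using Q(6)[of v1 q z1 z] z adj_not_diam[of q z] ord V by auto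
  qed
  ultimately have "w = v1" "u = z1"
    using uz wv index_from_inj[OF f] V by (metis le_neq_implies_less)+
  \<comment> \<open>The trapezoid is \<open>v1\<close>, \<open>q\<close>, \<open>z1\<close>,
    \<open>p\<close>, with apex \<open>v\<close> beyond \<open>v1 q\<close> and apex
    \<open>z\<close> beyond \<open>z1 p\<close>.\<close>
  moreover have "cyc v1 v q" "cyc v1 q z1" "cyc v1 z1 z" "cyc v1 z p"
    using index_from_cyc[OF f] ord V by auto
  ultimately show False
    using no_trapezoid[of v1 v q z1 z p] z(1,2,3) v(1,2,3) D pq(2) sym by simp
qed

text \<open>Rightmost neighbours inject \<open>C\<close> into the uncovered vertices, and
  \<open>C\<close> meets every edge of the matching, so |covered| <= 2 |C| <= 2 (|V| -
  |covered|).\<close>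

lemma card_covered_le: "3 * card covered \<le> 2 * card V"
proof -
  define r where "r x = (THE y. rightmost x y)" for x
  define m where "m x = (THE y. inner_edge x y)" for x
  have m: "inner_edge x (m x)" if "x \<in> covered" for x
    using that inner_edge_unique theI'[of "inner_edge x"] unfolding m_def covered_def by blast
  have r: "rightmost x (r x)" if "x \<in> covered" for x
  proof -
    have "\<exists>!y. rightmost x y"
      using m[OF that] ex_rightmost rightmost_unique by (auto simp: inner_edge_def)
    then show ?thesis unfolding r_def by (rule theI')
  qed
  have m_cov: "m x \<in> covered" if "x \<in> covered" for x
    using m[OF that] inner_edge_sym by (auto simp: covered_def)
  have mm: "m (m x) = x" if "x \<in> covered" for x
    using inner_edge_unique[OF m[OF m_cov[OF that]] inner_edge_sym[OF m[OF that]]] .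
  define C where "C = {x \<in> covered. r x \<notin> covered}"
  have "inj_on r covered"
    using r m inner_edge_sym inner_edges_share_target by (intro inj_onI) metis
  then have "inj_on r C" by (rule inj_on_subset) (auto simp: C_def)
  moreover have "r ` C \<subseteq> V - covered"
    using r adj_in2 by (auto simp: C_def rightmost_def)
  ultimately have "card C \<le> card (V - covered)"
    using finite_V by (intro card_inj_on_le) auto
  moreover have "card (V - covered) = card V - card covered"
    using covered_subset finite_covered by (rule card_Diff_subset[rotated])
  moreover have "card covered \<le> card V" using covered_subset finite_V by (rule card_mono[rotated])
  moreover have "card covered \<le> 2 * card C"
  proof -
    have finC: "finite C" using finite_covered by (simp add: C_def)
    have "covered \<subseteq> C \<union> m ` C"
    proof
      fix x assume x: "x \<in> covered"
      have "r x \<notin> covered \<or> r (m x) \<notin> covered"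
        using not_both_targets_covered[OF m[OF x] r[OF x] r[OF m_cov[OF x]]] by (auto simp: covered_def)
      then show "x \<in> C \<union> m ` C"
        using x m_cov[OF x] mm[OF x] by (auto simp: C_def image_iff intro: bexI[of _ "m x"])
    qed
    then have "card covered \<le> card (C \<union> m ` C)" using finC by (intro card_mono) auto
    also have "\<dots> \<le> card C + card (m ` C)" by (rule card_Un_le)
    also have "\<dots> \<le> 2 * card C" using card_image_le[OF finC, of m] by simp
    finally show ?thesis .
  qed
  ultimately show ?thesis by linarith
qed

lemma card_adj_le_convex: "3 * card {(x, y). adj x y} \<le> 8 * card V"
  using card_adj_le card_covered_le by (simp add: card_inner_edges)

end

section \<open>Planar vectors\<close>

definition cross2 :: "real ^ 2 \<Rightarrow> real ^ 2 \<Rightarrow> real" where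
  "cross2 u v = u $ 1 * v $ 2 - u $ 2 * v $ 1"

text \<open>Twice the signed area of the triangle; positive when \<open>a\<close> lies to the right
  of \<open>b\<close> seen from \<open>x\<close>.\<close>

definition orient :: "real ^ 2 \<Rightarrow> real ^ 2 \<Rightarrow> real ^ 2 \<Rightarrow> real" where
  "orient x a b = cross2 (a - x) (b - x)"

lemma inner_vec2: "(u :: real ^ 2) \<bullet> v = u $ 1 * v $ 1 + u $ 2 * v $ 2"
  by (simp add: inner_vec_def UNIV_2)

lemma vec2_eq_iff: "(u :: real ^ 2) = v \<longleftrightarrow> u $ 1 = v $ 1 \<and> u $ 2 = v $ 2"
  by (auto simp: vec_eq_iff forall_2)

lemma dist_eq_iff_inner: "0 \<le> r \<Longrightarrow> dist x y = r \<longleftrightarrow> (x - y) \<bullet> (x - y) = r\<^sup>2"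
  for x y :: "'a :: real_inner"
  by (metis dist_norm dot_square_norm norm_ge_zero power2_eq_iff_nonneg)

lemma dist_le_iff_inner: "0 \<le> r \<Longrightarrow> dist x y \<le> r \<longleftrightarrow> (x - y) \<bullet> (x - y) \<le> r\<^sup>2"
  for x y :: "'a :: real_inner"
  by (metis abs_le_square_iff abs_norm_cancel abs_of_nonneg dist_norm dot_square_norm)

lemma cross2_skew: "cross2 v u = - cross2 u v"
  by (simp add: cross2_def)

lemma cross2_self [simp]: "cross2 u u = 0"
  by (simp add: cross2_def)

lemma cross2_zero [simp]: "cross2 0 u = 0" "cross2 u 0 = 0"
  by (simp_all add: cross2_def)

lemma cross2_eq_0D:
  assumes "cross2 u v = 0" shows "(u \<bullet> u) *\<^sub>R v = (u \<bullet> v) *\<^sub>R u"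
proof -
  have "(u \<bullet> u) * v $ 1 - (u \<bullet> v) * u $ 1 = - (u $ 2) * cross2 u v"
    "(u \<bullet> u) * v $ 2 - (u \<bullet> v) * u $ 2 = u $ 1 * cross2 u v"
    by (simp_all add: inner_vec2 cross2_def algebra_simps)
  then show ?thesis using assms by (simp add: vec2_eq_iff)
qed

lemma cross2_linear:
  "cross2 (u + v) x = cross2 u x + cross2 v x" "cross2 (u - v) x = cross2 u x - cross2 v x"
  "cross2 x (u + v) = cross2 x u + cross2 x v" "cross2 x (u - v) = cross2 x u - cross2 x v"
  "cross2 (c *\<^sub>R u) x = c * cross2 u x" "cross2 x (c *\<^sub>R u) = c * cross2 x u"
  "cross2 (- u) x = - cross2 u x" "cross2 x (- u) = - cross2 x u"
  by (simp_all add: cross2_def algebra_simps)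

text \<open>The cosine of a difference of angles measured from \<open>a\<close>, without division.
  \<open>cross2_mult_inner2\<close> is the corresponding sine formula.\<close>

lemma inner_mult_inner2:
  "(a \<bullet> b) * (a \<bullet> c) + cross2 a b * cross2 a c = (a \<bullet> a) * (b \<bullet> c)"
  by (simp add: cross2_def inner_vec2 algebra_simps)

lemma cross2_mult_inner2:
  "cross2 a c * (a \<bullet> b) - cross2 a b * (a \<bullet> c) = (a \<bullet> a) * cross2 b c"
  by (simp add: cross2_def inner_vec2 algebra_simps)

lemma inner2_lagrange: "(a \<bullet> b)\<^sup>2 + (cross2 a b)\<^sup>2 = (a \<bullet> a) * (b \<bullet> b)"
  using inner_mult_inner2[of a b b] by (simp add: power2_eq_square)

lemma orient_rotate: "orient b c a = orient a b c"
  by (simp add: orient_def cross2_def algebra_simps)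

lemma orient_skew: "orient a c b = - orient a b c"
  by (simp add: orient_def cross2_def algebra_simps)

text \<open>Three plane vectors satisfy a linear relation whose coefficients are their cross
  products; its product with \<open>g\<close> expresses the claim by positive terms.\<close>

lemma cross2_trans_halfplane:
  assumes "g \<bullet> a > 0" "g \<bullet> b > 0" "g \<bullet> c > 0" "cross2 a b > 0" "cross2 b c > 0"
  shows "cross2 a c > 0"
proof -
  have "cross2 a c * (g \<bullet> b) = cross2 a b * (g \<bullet> c) + cross2 b c * (g \<bullet> a)"
    by (simp add: cross2_def inner_vec2 algebra_simps)
  also have "\<dots> > 0" using assms by (simp add: add_pos_pos)
  finally show ?thesis using assms(2) by (simp add: zero_less_mult_iff)
qed

lemma cross2_eq_0_halfplane:
  assumes "g \<bullet> a > 0" "g \<bullet> b > 0" "a \<bullet> a = b \<bullet> b" "cross2 a b = 0"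
  shows "a = b"
proof -
  have "(a \<bullet> b)\<^sup>2 = (a \<bullet> a)\<^sup>2"
    using inner2_lagrange[of a b] assms by (simp add: power2_eq_square)
  then consider "a \<bullet> b = a \<bullet> a" | "a \<bullet> b = - (a \<bullet> a)" by (auto simp: power2_eq_iff)
  then show ?thesis
  proof cases
    case 1
    then have "(a - b) \<bullet> (a - b) = 0" using assms(3) by (simp add: algebra_simps inner_commute)
    then show ?thesis by simp
  next
    case 2
    then have "(a + b) \<bullet> (a + b) = 0" using assms(3) by (simp add: algebra_simps inner_commute)
    then have "b = - a" by (simp add: add_eq_0_iff)
    then show ?thesis using assms(1,2) by simp
  qed
qed

text \<open>For vectors of equal length in a half-plane the cosine decreases with the angle.\<close>

lemma cos_antimono_aux:
  fixes x y x' y' :: real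
  assumes eq: "x\<^sup>2 + y\<^sup>2 = x'\<^sup>2 + y'\<^sup>2" and pos: "y > 0" "y' > 0" and less: "y * x' < y' * x"
  shows "x' < x"
proof (rule ccontr)
  assume "\<not> x' < x"
  then have le: "x \<le> x'" by simp
  show False
  \<comment> \<open>For nonnegative \<open>x\<close> the inequality \<open>less\<close> forces
    \<open>y < y'\<close> although |x| <= |x'|; for negative \<open>x\<close> it forces
    \<open>y' < y\<close> although |x'| <= |x|. Both contradict the equal radii.\<close>
  proof (cases "x \<ge> 0")
    case True
    then have "y * x \<le> y * x'" using le pos by simp
    then have "y * x < y' * x" using less by simp
    then have "y < y'" using True by (metis mult_less_cancel_right not_less)
    then have "y\<^sup>2 < y'\<^sup>2" using pos by (simp add: power_strict_mono)
    moreover have "x\<^sup>2 \<le> x'\<^sup>2" using True le by (simp add: power_mono)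
    ultimately show False using eq by simp
  next
    case False
    have "x' < 0"
    proof (rule ccontr)
      assume "\<not> x' < 0"
      then have "0 \<le> y * x'" using pos by simp
      moreover have "y' * x < 0" using False pos by (simp add: mult_pos_neg)
      ultimately show False using less by simp
    qed
    have "y' * x \<le> y' * x'" using le pos by simp
    then have "y * x' < y' * x'" using less by simp
    then have "y' < y" using \<open>x' < 0\<close> by (metis mult_less_cancel_right not_less order_less_imp_le)
    then have "y'\<^sup>2 < y\<^sup>2" using pos by (simp add: power_strict_mono)
    moreover have "x'\<^sup>2 \<le> x\<^sup>2" using le \<open>x' < 0\<close> by (simp add: abs_le_square_iff[symmetric])
    ultimately show False using eq by simp
  qed
qed

text \<open>Inner and cross product with \<open>a\<close> are coordinates on a circle of radius
  \<open>r\<close>, where \<open>cos_antimono_aux\<close> applies. The second claim measures from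
  \<open>c\<close>, with reversed sign.\<close>

lemma inner2_antimono:
  assumes "a \<bullet> a = r" "b \<bullet> b = r" "c \<bullet> c = r"
    and cr: "cross2 a b > 0" "cross2 b c > 0" "cross2 a c > 0"
  shows "a \<bullet> c < a \<bullet> b" "a \<bullet> c < b \<bullet> c"
proof -
  have r: "r > 0" using assms(1) cr(1) inner_gt_zero_iff[of a] by (auto simp: cross2_def)
  have "cross2 a c * (a \<bullet> b) - cross2 a b * (a \<bullet> c) > 0"
    using cross2_mult_inner2[of a c b] assms r by simp
  moreover have "(a \<bullet> b)\<^sup>2 + (cross2 a b)\<^sup>2 = (a \<bullet> c)\<^sup>2 + (cross2 a c)\<^sup>2"
    using assms(1-3) by (simp add: inner2_lagrange)
  ultimately show "a \<bullet> c < a \<bullet> b"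
    using cos_antimono_aux[of "a \<bullet> b" "cross2 a b" "a \<bullet> c" "cross2 a c"] cr by simp
  have "cross2 c a * (c \<bullet> b) - cross2 c b * (c \<bullet> a) < 0"
    using cross2_mult_inner2[of c a b] assms r cross2_skew[of b a] by simp
  moreover have "(c \<bullet> b)\<^sup>2 + (cross2 c b)\<^sup>2 = (c \<bullet> a)\<^sup>2 + (cross2 c a)\<^sup>2"
    using assms(1-3) by (simp add: inner2_lagrange)
  ultimately show "a \<bullet> c < b \<bullet> c"
    using cos_antimono_aux[of "c \<bullet> b" "- cross2 c b" "c \<bullet> a" "- cross2 c a"] cr
      cross2_skew[of b c] cross2_skew[of a c] by (simp add: inner_commute)
qed

text \<open>For a zigzag starting at \<open>a\<close>, with its middle edge from the origin to
  \<open>u\<close> and its other end at \<open>u - c\<close>, the vector \<open>u - c - a\<close>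
  joins the ends. The excess of its square over \<open>r\<close>, times \<open>r / 2\<close>, splits
  into a nonnegative product and a product of sines.\<close>

lemma zigzag_long:
  assumes r: "a \<bullet> a = r" "c \<bullet> c = r" "u \<bullet> u = r" and cr: "cross2 a u > 0" "cross2 c u > 0"
  shows "(u - c - a) \<bullet> (u - c - a) > r"
proof -
  have r0: "r > 0" using r(3) cr(1) inner_gt_zero_iff[of u] by (auto simp: cross2_def)
  have le: "u \<bullet> a \<le> r" "u \<bullet> c \<le> r"
    using norm_cauchy_schwarz[of u a] norm_cauchy_schwarz[of u c] r r0 by (simp_all add: norm_eq_sqrt_inner)
  have "r * (a \<bullet> c) = (u \<bullet> a) * (u \<bullet> c) + cross2 u a * cross2 u c"
    using inner_mult_inner2[of u a c] r by simp
  then have "r * (r - u \<bullet> a - u \<bullet> c + a \<bullet> c)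
    = (r - u \<bullet> a) * (r - u \<bullet> c) + cross2 a u * cross2 c u"
    using cross2_skew[of a u] cross2_skew[of c u] by (simp add: algebra_simps)
  also have "\<dots> > 0" using le cr by (intro add_nonneg_pos mult_nonneg_nonneg) auto
  finally have "r - u \<bullet> a - u \<bullet> c + a \<bullet> c > 0" using r0 by (simp add: zero_less_mult_iff)
  moreover have "(u - c - a) \<bullet> (u - c - a) = u \<bullet> u + c \<bullet> c + a \<bullet> a - 2 * (u \<bullet> a) - 2 * (u \<bullet> c) + 2 * (a \<bullet> c)"
    by (simp add: algebra_simps inner_commute)
  ultimately show ?thesis using r by simp
qed

lemma mult_le_of_squares:
  fixes x y m :: real
  assumes "x\<^sup>2 \<le> m" "y\<^sup>2 \<le> m" shows "x * y \<le> m"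
  using assms sum_squares_bound[of x y] by simp

text \<open>Two circles meet in points symmetric about the line through their centres; the angles
  allowed here put a and b on the same side of it.\<close>

lemma zigzag_unique:
  assumes r: "a \<bullet> a = r" "b \<bullet> b = r" "c \<bullet> c = r" "u \<bullet> u = r"
    and cr: "cross2 a b > 0" "cross2 b u > 0" "cross2 a u > 0" "cross2 c u > 0"
    and close: "2 * (a \<bullet> b) \<ge> r" "2 * (b \<bullet> u) \<ge> r"
  shows "(u - c - a) \<bullet> (u - c - a) \<noteq> (u - c - b) \<bullet> (u - c - b)"
proof
  assume eq: "(u - c - a) \<bullet> (u - c - a) = (u - c - b) \<bullet> (u - c - b)"
  have r0: "r > 0" using r(4) cr(2) inner_gt_zero_iff[of u] by (auto simp: cross2_def)
  \<comment> \<open>Equal distances make \<open>v\<close> orthogonal to \<open>a - b\<close>, and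
    equal lengths do the same for \<open>a + b\<close>; hence \<open>v\<close> and \<open>s\<close>
    are parallel.\<close>
  define v s e where "v = c - u" and "s = a + b" and "e = a - b"
  have ve: "e \<bullet> v = 0" using eq r by (simp add: v_def e_def algebra_simps inner_commute)
  have se: "e \<bullet> s = 0" using r by (simp add: s_def e_def algebra_simps inner_commute)
  have "a \<noteq> b" using cr(1) by auto
  then have "e \<bullet> e > 0" by (simp add: e_def)
  then have vs: "cross2 v s = 0" using cross2_mult_inner2[of e s v] ve se by simp
  \<comment> \<open>By \<open>close\<close> both consecutive angles are at most 60 degrees, so
    \<open>a\<close> and \<open>u\<close> are at most 120 degrees apart and \<open>u\<close> has a
    nonnegative product with \<open>s\<close>.\<close>
  have sq: "(cross2 a b)\<^sup>2 \<le> 3 / 4 * r\<^sup>2" "(cross2 b u)\<^sup>2 \<le> 3 / 4 * r\<^sup>2"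
  proof -
    have "(r / 2)\<^sup>2 \<le> (a \<bullet> b)\<^sup>2" "(r / 2)\<^sup>2 \<le> (b \<bullet> u)\<^sup>2"
      using close r0 by (intro power_mono; simp)+
    then show "(cross2 a b)\<^sup>2 \<le> 3 / 4 * r\<^sup>2" "(cross2 b u)\<^sup>2 \<le> 3 / 4 * r\<^sup>2"
      using inner2_lagrange[of a b] inner2_lagrange[of b u] r by (simp_all add: power2_eq_square)
  qed
  have "r * (a \<bullet> u) = (a \<bullet> b) * (b \<bullet> u) - cross2 a b * cross2 b u"
    using inner_mult_inner2[of b a u] r cross2_skew[of b a] by (simp add: inner_commute)
  moreover have "(r / 2) * (r / 2) \<le> (a \<bullet> b) * (b \<bullet> u)"
    using close r0 by (intro mult_mono) auto
  moreover have "cross2 a b * cross2 b u \<le> 3 / 4 * r\<^sup>2" using sq by (rule mult_le_of_squares)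
  ultimately have "r * (a \<bullet> u) \<ge> r * (- (r / 2))" by (simp add: power2_eq_square)
  then have "a \<bullet> u \<ge> - (r / 2)" using r0 by (simp only: mult_le_cancel_left_pos)
  then have su: "u \<bullet> s \<ge> 0" using close by (simp add: s_def algebra_simps inner_commute)
  have "(c \<bullet> u)\<^sup>2 < r\<^sup>2"
  proof -
    have "(cross2 c u)\<^sup>2 > 0" using cr(4) by simp
    then show ?thesis using inner2_lagrange[of c u] unfolding r power2_eq_square by linarith
  qed
  then have "c \<bullet> u < r" by (rule power2_less_imp_less) (use r0 in simp)
  then have vu: "u \<bullet> v < 0" using r by (simp add: v_def algebra_simps inner_commute)
  \<comment> \<open>Both \<open>s\<close> and \<open>v\<close> lie on the same side of
    \<open>u\<close>, but only \<open>v\<close> makes an obtuse angle with it, so they cannot be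
    parallel.\<close>
  have us: "cross2 u s < 0" "cross2 u v < 0"
    using cr cross2_skew[of s u] cross2_skew[of v u] by (simp_all add: s_def v_def cross2_linear)
  have "cross2 u s * (u \<bullet> v) - cross2 u v * (u \<bullet> s) = 0"
    using cross2_mult_inner2[of u s v] vs by simp
  moreover have "cross2 u s * (u \<bullet> v) > 0" using us vu by (simp add: mult_neg_neg)
  moreover have "cross2 u v * (u \<bullet> s) \<le> 0" using us su by (simp add: mult_nonpos_nonneg)
  ultimately show False by linarith
qed

text \<open>The half \<open>s >= 0\<close> of \<open>degree_three_impossible\<close> in coordinates
  along \<open>u\<close>: the terms in \<open>A\<close> and \<open>B\<close> are \<open>r\<close>
  times the products of \<open>p\<close> with \<open>a\<close> and \<open>b\<close>. The premise of
  \<open>A\<close> holds by signs, that of \<open>B\<close> by the 60 degree bounds, and the two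
  equations then have opposite signs.\<close>

lemma degree_three_aux:
  fixes t s ca sa cb sb r :: real
  assumes r: "r > 0" and t: "t \<ge> 0" and s: "s \<ge> 0" and sa: "sa > 0" and sb: "sb > 0"
    and sq: "ca\<^sup>2 + sa\<^sup>2 = r\<^sup>2" "cb\<^sup>2 + sb\<^sup>2 = r\<^sup>2"
    and ca: "2 * ca \<ge> r" and cb: "2 * cb \<ge> r"
    and A: "- t * ca - s * sa \<le> 0 \<Longrightarrow> - t * ca - s * sa = - t * r"
    and B: "- t * cb + s * sb \<le> 0 \<Longrightarrow> - t * cb + s * sb = - t * r"
  shows "t = 0 \<and> s = 0"
proof -
  have A': "t * (r - ca) = s * sa"
  proof -
    have "t * ca \<ge> 0" "s * sa \<ge> 0" using t s sa ca r by simp_all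
    then show ?thesis using A by (simp add: algebra_simps)
  qed
  have "(r / 2)\<^sup>2 \<le> ca\<^sup>2" "(r / 2)\<^sup>2 \<le> cb\<^sup>2" using ca cb r by (intro power_mono; simp)+
  then have "sa\<^sup>2 \<le> 3 / 4 * r\<^sup>2" "sb\<^sup>2 \<le> 3 / 4 * r\<^sup>2" using sq by (simp_all add: power2_eq_square)
  then have ss: "sa * sb \<le> 3 / 4 * r\<^sup>2" by (rule mult_le_of_squares)
  have "(3 / 2 * r) * (r / 2) \<le> (r + ca) * cb" using r ca cb by (intro mult_mono) auto
  then have "sa * sb \<le> (r + ca) * cb" using ss by (simp add: power2_eq_square)
  then have "sa * (sa * sb) \<le> sa * ((r + ca) * cb)" using sa by simp
  \<comment> \<open>Writing the square of \<open>sa\<close> as a product lets the factor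
    \<open>r + ca\<close> cancel.\<close>
  moreover have "sa * sa = (r + ca) * (r - ca)"
    using sq(1) by (simp add: power2_eq_square algebra_simps)
  then have "sa * (sa * sb) = (r + ca) * ((r - ca) * sb)"
    by (simp only: mult.assoc[symmetric])
  ultimately have "(r + ca) * ((r - ca) * sb) \<le> (r + ca) * (sa * cb)"
    by (simp only: mult.left_commute mult.assoc)
  moreover have "r + ca > 0" using r ca by simp
  ultimately have "(r - ca) * sb \<le> sa * cb" by simp
  then have "t * ((r - ca) * sb) \<le> t * (sa * cb)" using t by (rule mult_left_mono)
  moreover have "sa * (- t * cb + s * sb) = t * (r - ca) * sb - t * (sa * cb)"
    unfolding A' by (simp add: algebra_simps)
  ultimately have "sa * (- t * cb + s * sb) \<le> 0" by (simp add: algebra_simps)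
  then have "- t * cb + s * sb \<le> 0" using sa by (simp add: mult_le_0_iff)
  then have B': "s * sb = - (t * (r - cb))" using B by (simp add: algebra_simps)
  have lt: "ca < r" "cb < r"
    using sq sa sb r by (smt (verit) power_mono zero_less_power)+
  have "t * (r - cb) \<ge> 0" using t lt by simp
  moreover have "s * sb \<ge> 0" using s sb by simp
  ultimately have "s * sb = 0" "t * (r - cb) = 0" using B' by linarith+
  then show ?thesis using lt sb by auto
qed

text \<open>The origin is a point with neighbours a, u, b, and p is another point. Distances above
  the common length of a, u, b all agree, so p would be equidistant from three points of a circle.\<close>

lemma degree_three_impossible:
  assumes r: "a \<bullet> a = r" "b \<bullet> b = r" "u \<bullet> u = r"
    and cr: "cross2 a u > 0" "cross2 u b > 0"
    and close: "2 * (a \<bullet> u) \<ge> r" "2 * (u \<bullet> b) \<ge> r"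
    and p: "p \<bullet> u \<le> 0" "p \<noteq> 0"
    and far: "\<And>e. e \<in> {a, b, u} \<Longrightarrow> p \<bullet> e \<le> 0 \<Longrightarrow> p \<bullet> e = m"
  shows False
proof -
  have r0: "r > 0" using r(3) cr(1) inner_gt_zero_iff[of u] by (auto simp: cross2_def)
  \<comment> \<open>Components of \<open>p\<close> along and across \<open>u\<close> up to a common
    factor; the sign makes \<open>t\<close> nonnegative.\<close>
  define t s where "t = - (u \<bullet> p)" and "s = cross2 u p"
  have m: "m = - t" using far[of u] p by (simp add: t_def inner_commute)
  have a: "r * (p \<bullet> a) = - t * (u \<bullet> a) - s * cross2 a u"
    using inner_mult_inner2[of u p a] r cross2_skew[of u a] by (simp add: t_def s_def)
  have b: "r * (p \<bullet> b) = - t * (u \<bullet> b) + s * cross2 u b"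
    using inner_mult_inner2[of u p b] r by (simp add: t_def s_def)
  have far_r: "r * (p \<bullet> e) \<le> 0 \<Longrightarrow> r * (p \<bullet> e) = - t * r" if "e \<in> {a, b, u}" for e
    using far[OF that] r0 m by (simp add: mult_le_0_iff)
  have far': "- t * (u \<bullet> a) - s * cross2 a u \<le> 0 \<Longrightarrow> - t * (u \<bullet> a) - s * cross2 a u = - t * r"
    "- t * (u \<bullet> b) + s * cross2 u b \<le> 0 \<Longrightarrow> - t * (u \<bullet> b) + s * cross2 u b = - t * r"
    using far_r[of a] far_r[of b] unfolding a b by simp_all
  have sq: "(u \<bullet> a)\<^sup>2 + (cross2 a u)\<^sup>2 = r\<^sup>2" "(u \<bullet> b)\<^sup>2 + (cross2 u b)\<^sup>2 = r\<^sup>2"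
    using inner2_lagrange[of u a] inner2_lagrange[of u b] r cross2_skew[of a u]
    by (simp_all add: power2_eq_square)
  have t0: "t \<ge> 0" using p by (simp add: t_def inner_commute)
  have cl: "2 * (u \<bullet> a) \<ge> r" "2 * (u \<bullet> b) \<ge> r" using close by (simp_all add: inner_commute)
  have "t = 0 \<and> s = 0"
  proof (cases "s \<ge> 0")
    case True
    then show ?thesis using degree_three_aux[OF r0 t0 True cr sq cl far'] by simp
  next
    case False
    \<comment> \<open>Reflection in the line of \<open>u\<close> swaps \<open>a\<close> with
      \<open>b\<close> and negates \<open>s\<close>.\<close>
    then have "- s \<ge> 0" by simp
    then have "t = 0 \<and> - s = 0"
      using degree_three_aux[OF r0 t0 _ cr(2,1) sq(2,1) cl(2,1), of "- s"] far' by simp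
    then show ?thesis by simp
  qed
  then have "r * (p \<bullet> p) = 0" using inner2_lagrange[of u p] r by (simp add: t_def s_def)
  then show False using p r0 by simp
qed

text \<open>The trapezoid has vertices P = 0, Q = e, R = s + f, S = s. Comparing the apex a beyond PQ with
  the height g / 2 gives |e| > 2 |f|, and the apex b beyond RS gives |f| > 2 |e|.\<close>

lemma trapezoid_impossible:
  assumes PS: "s \<bullet> s = r" and QR: "(s + f - e) \<bullet> (s + f - e) = r"
    and diag: "(s + f) \<bullet> (s + f) = (s - e) \<bullet> (s - e)"
    and A: "(s + f - a) \<bullet> (s + f - a) = r" "(s - a) \<bullet> (s - a) = r"
    and B: "b \<bullet> b = r" "(b - e) \<bullet> (b - e) = r"
    and cr: "cross2 a e > 0" "cross2 e (s + f) > 0" "cross2 e s > 0" "cross2 f s > 0" "cross2 f (b - s) > 0"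
  shows False
proof -
  \<comment> \<open>Doubled vectors, to avoid halves: \<open>g\<close> from the midpoint of PQ to
    that of RS, \<open>h\<close> from \<open>a\<close> to the midpoint of RS, \<open>k\<close> from
    the midpoint of PQ to \<open>b\<close>.\<close>
  define g where "g = 2 *\<^sub>R s - e + f"
  define h where "h = 2 *\<^sub>R s + f - 2 *\<^sub>R a"
  define k where "k = 2 *\<^sub>R b - e"
  \<comment> \<open>Equal legs and equal diagonals make \<open>g\<close> orthogonal to both bases,
    which are therefore parallel.\<close>
  have ge: "g \<bullet> e = 0" and gf: "g \<bullet> f = 0"
    using PS QR diag by (simp_all add: g_def algebra_simps inner_commute)
  have g0: "g \<bullet> g > 0"
  proof -
    have "cross2 e g = 2 * cross2 e s + cross2 e f" by (simp add: g_def cross2_linear)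
    moreover have "cross2 e s + cross2 e f > 0" using cr(2) by (simp add: cross2_linear)
    ultimately have "cross2 e g > 0" using cr(3) by simp
    then have "g \<noteq> 0" by (auto simp: cross2_def)
    then show ?thesis by simp
  qed
  then have ef: "cross2 e f = 0" using cross2_mult_inner2[of g f e] ge gf by simp
  have ee: "e \<bullet> e > 0" and ff: "f \<bullet> f > 0" using cr(3,4) by (auto simp: cross2_def)
  have ef_pos: "e \<bullet> f > 0"
  proof -
    have "cross2 e s * (e \<bullet> f) = (e \<bullet> e) * cross2 f s" using cross2_mult_inner2[of e s f] ef by simp
    also have "\<dots> > 0" using ee cr(4) by simp
    finally show ?thesis using cr(3) by (simp add: zero_less_mult_iff)
  qed
  have hf: "h \<bullet> f = 0" using A by (simp add: h_def algebra_simps inner_commute)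
  have ke: "k \<bullet> e = 0" using B by (simp add: k_def algebra_simps inner_commute)
  have he: "h \<bullet> e = 0"
    using inner_mult_inner2[of f h e] hf ef ff cross2_skew[of f e] by (simp add: inner_commute)
  have kf: "k \<bullet> f = 0"
    using inner_mult_inner2[of e k f] ke ef ee by (simp add: inner_commute)
  have QR': "g \<bullet> g + f \<bullet> f - 2 * (e \<bullet> f) + e \<bullet> e = 4 * r"
  proof -
    have "4 * r = (2 *\<^sub>R (s + f - e)) \<bullet> (2 *\<^sub>R (s + f - e))" using QR by simp
    also have "2 *\<^sub>R (s + f - e) = g + f - e" by (simp add: g_def algebra_simps scaleR_2)
    finally show ?thesis using ge gf by (simp add: algebra_simps inner_commute)
  qed
  have A': "h \<bullet> h + f \<bullet> f = 4 * r"
  proof -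
    have "4 * r = (2 *\<^sub>R (s - a)) \<bullet> (2 *\<^sub>R (s - a))" using A by simp
    also have "2 *\<^sub>R (s - a) = h - f" by (simp add: h_def algebra_simps)
    finally show ?thesis using hf by (simp add: algebra_simps inner_commute)
  qed
  have B': "k \<bullet> k + e \<bullet> e = 4 * r"
  proof -
    have "4 * r = (2 *\<^sub>R b) \<bullet> (2 *\<^sub>R b)" using B by simp
    also have "2 *\<^sub>R b = k + e" by (simp add: k_def)
    finally show ?thesis using ke by (simp add: algebra_simps inner_commute)
  qed
  \<comment> \<open>As \<open>a\<close> lies beyond PQ, it is further from the midpoint of RS than
    the height of the trapezoid.\<close>
  have "g \<bullet> g < h \<bullet> h"
  proof -
    have "cross2 e g > 0" using cr(3) ef by (simp add: g_def cross2_linear)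
    moreover have "cross2 e g < cross2 e h"
      using cr(1) ef cross2_skew[of e a] by (simp add: g_def h_def cross2_linear)
    ultimately have "(cross2 e g)\<^sup>2 < (cross2 e h)\<^sup>2" by (simp add: power_strict_mono)
    then have "(e \<bullet> e) * (g \<bullet> g) < (e \<bullet> e) * (h \<bullet> h)"
      using inner2_lagrange[of e g] inner2_lagrange[of e h] ge he by (simp add: inner_commute)
    then show ?thesis using ee by simp
  qed
  moreover have "g \<bullet> g < k \<bullet> k"
  proof -
    have fe: "cross2 f e = 0" using ef cross2_skew[of e f] by simp
    have "cross2 f g > 0" using cr(4) fe by (simp add: g_def cross2_linear)
    moreover have "cross2 f g < cross2 f k"
      using cr(5) fe by (simp add: g_def k_def cross2_linear)
    ultimately have "(cross2 f g)\<^sup>2 < (cross2 f k)\<^sup>2" by (simp add: power_strict_mono)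
    then have "(f \<bullet> f) * (g \<bullet> g) < (f \<bullet> f) * (k \<bullet> k)"
      using inner2_lagrange[of f g] inner2_lagrange[of f k] gf kf by (simp add: inner_commute)
    then show ?thesis using ff by simp
  qed
  ultimately have "2 * (e \<bullet> f) < e \<bullet> e" "2 * (e \<bullet> f) < f \<bullet> f" using QR' A' B' by linarith+
  then have "(2 * (e \<bullet> f)) * (2 * (e \<bullet> f)) < (e \<bullet> e) * (f \<bullet> f)"
    using ef_pos by (intro mult_strict_mono) auto
  moreover have "(e \<bullet> f) * (e \<bullet> f) = (e \<bullet> e) * (f \<bullet> f)"
    using inner2_lagrange[of e f] ef by (simp add: power2_eq_square)
  moreover have "(e \<bullet> f) * (e \<bullet> f) > 0" using ef_pos by simp
  ultimately show False by linarith
qed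

text \<open>The diagonals cross in a point \<open>m\<close>; adding the triangle inequalities at
  \<open>m\<close> gives the claim, strictly because \<open>m\<close> is not on the side
  \<open>p q\<close>.\<close>

lemma dist_diagonals_gt:
  assumes pqr: "orient p q r > 0" and prs: "orient p r s > 0"
    and pqs: "orient p q s > 0" and qrs: "orient q r s > 0"
  shows "dist p q + dist r s < dist p r + dist q s"
proof -
  \<comment> \<open>Twice the area of the quadrilateral. The ratios \<open>t\<close> and
    \<open>l\<close> of areas locate \<open>m\<close> on the two diagonals.\<close>
  define \<sigma> where "\<sigma> = orient p q r + orient p r s"
  have \<sigma>: "\<sigma> = orient p q s + orient q r s" "\<sigma> > 0"
    using pqr prs by (auto simp: \<sigma>_def orient_def cross2_def algebra_simps)
  define t where "t = orient p q s / \<sigma>"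
  define l where "l = orient p q r / \<sigma>"
  define m where "m = p + t *\<^sub>R (r - p)"
  have t: "0 < t" "t < 1" and l: "0 < l" "l < 1"
    using pqr prs pqs qrs \<sigma> by (simp_all add: t_def l_def \<sigma>_def)
  have m': "m = q + l *\<^sub>R (s - q)"
  proof -
    have "\<sigma> *\<^sub>R p + orient p q s *\<^sub>R (r - p) = \<sigma> *\<^sub>R q + orient p q r *\<^sub>R (s - q)"
      by (simp add: vec2_eq_iff \<sigma>_def orient_def cross2_def algebra_simps)
    then have "(1 / \<sigma>) *\<^sub>R (\<sigma> *\<^sub>R p + orient p q s *\<^sub>R (r - p)) = (1 / \<sigma>) *\<^sub>R (\<sigma> *\<^sub>R q + orient p q r *\<^sub>R (s - q))"
      by simp
    then show ?thesis using \<sigma>(2) by (simp add: m_def t_def l_def scaleR_add_right)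
  qed
  have "m \<in> closed_segment p r"
    unfolding closed_segment_def mem_Collect_eq
    by (rule exI[of _ t]) (use t in \<open>simp add: m_def algebra_simps\<close>)
  moreover have "m \<in> closed_segment q s"
    unfolding closed_segment_def mem_Collect_eq
    by (rule exI[of _ l]) (use l in \<open>simp add: m' algebra_simps\<close>)
  ultimately have pr: "dist p r = dist p m + dist m r" and qs: "dist q s = dist q m + dist m s"
    by (simp_all add: between_mem_segment[symmetric] between)
  have "m \<notin> closed_segment p q"
  proof
    assume "m \<in> closed_segment p q"
    then obtain v where "m = (1 - v) *\<^sub>R p + v *\<^sub>R q" by (auto simp: closed_segment_def)
    then have "m - p = v *\<^sub>R (q - p)" by (simp add: algebra_simps)
    then have "orient p q m = 0" by (simp add: orient_def cross2_linear)
    moreover have "orient p q m = t * orient p q r" by (simp add: m_def orient_def cross2_linear)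
    ultimately show False using t pqr by simp
  qed
  then have "dist p q \<noteq> dist p m + dist m q"
    by (simp add: between_mem_segment[symmetric] between)
  then have "dist p q < dist p m + dist m q" using dist_triangle[of p q m] by simp
  moreover have "dist r s \<le> dist m r + dist m s" using dist_triangle[of r s m] by (simp add: dist_commute)
  ultimately show ?thesis using pr qs by (simp add: dist_commute)
qed

section \<open>Convex layers\<close>

lemma extreme_point_endpoints:
  assumes "a extreme_point_of S" "convex S" "b \<in> S" "c \<in> S" "0 < u" "u < 1"
    and "a = (1 - u) *\<^sub>R b + u *\<^sub>R c"
  shows "b = c"
  using assms by (metis extreme_point_of_def in_segment(2))

lemma first_layer_subset: "finite X \<Longrightarrow> first_layer X \<subseteq> X"
  by (auto simp: first_layer_def dest: extreme_point_of_convex_hull)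

lemma convex_hull_first_layer: "finite X \<Longrightarrow> convex hull (first_layer X) = convex hull X"
  unfolding first_layer_def
  by (metis Krein_Milman_Minkowski convex_convex_hull finite_imp_compact_convex_hull)

lemma first_layer_nonempty: "finite X \<Longrightarrow> X \<noteq> {} \<Longrightarrow> first_layer X \<noteq> {}"
  by (metis convex_hull_eq_empty convex_hull_first_layer)

text \<open>The distance from \<open>a\<close> is convex, so over the hull it is largest at extreme
  points, and never at another point of a finite set's hull.\<close>

lemma not_first_layer_further:
  assumes "finite X" "x \<in> X" "x \<notin> first_layer X"
  shows "\<exists>v\<in>first_layer X. dist x a < dist v a"
proof -
  have "finite (first_layer X)" using first_layer_subset[OF assms(1)] assms(1) finite_subset by blast
  moreover have "x \<in> convex hull first_layer X"
    using assms convex_hull_first_layer hull_inc by metis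
  ultimately obtain y where y: "y \<in> convex hull first_layer X" "norm (x - a) < norm (y - a)"
    using simplex_furthest_lt[of "first_layer X" a] assms(3) by blast
  then obtain v where "v \<in> first_layer X" "norm (y - a) \<le> norm (v - a)"
    using simplex_furthest_le_exists[OF \<open>finite (first_layer X)\<close>, of a] by blast
  then show ?thesis using y by (intro bexI[of _ v]) (auto simp: dist_norm)
qed

lemma first_layer_orient_nonzero:
  assumes X: "finite X" and abc: "a \<in> first_layer X" "b \<in> first_layer X" "c \<in> first_layer X"
    and ne: "a \<noteq> b" "a \<noteq> c" "b \<noteq> c"
  shows "orient a b c \<noteq> 0"
proof
  assume 0: "orient a b c = 0"
  have ext: "x extreme_point_of convex hull X" "x \<in> convex hull X" if "x \<in> first_layer X" for x
    using that by (auto simp: first_layer_def extreme_point_of_def)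
  have no: "\<not> (0 < u \<and> u < 1 \<and> x = (1 - u) *\<^sub>R y + u *\<^sub>R z)"
    if "x \<in> first_layer X" "y \<in> first_layer X" "z \<in> first_layer X" "y \<noteq> z" for x y z u
    using extreme_point_endpoints[OF ext(1)[OF that(1)] convex_convex_hull ext(2)[OF that(2)] ext(2)[OF that(3)]]
      that(4) by blast
  \<comment> \<open>The position of \<open>c\<close> on the line through \<open>a\<close> at 0 and
    \<open>b\<close> at 1. It decides which of the three points lies between the others and so is
    not extreme.\<close>
  define u where "u = ((b - a) \<bullet> (c - a)) / ((b - a) \<bullet> (b - a))"
  have bb: "(b - a) \<bullet> (b - a) \<noteq> 0" using ne by simp
  have c: "c - a = u *\<^sub>R (b - a)"
  proof -
    have "((b - a) \<bullet> (b - a)) *\<^sub>R (c - a) = ((b - a) \<bullet> (c - a)) *\<^sub>R (b - a)"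
      using 0 by (intro cross2_eq_0D) (simp add: orient_def)
    then have "(1 / ((b - a) \<bullet> (b - a))) *\<^sub>R (((b - a) \<bullet> (b - a)) *\<^sub>R (c - a))
      = (1 / ((b - a) \<bullet> (b - a))) *\<^sub>R (((b - a) \<bullet> (c - a)) *\<^sub>R (b - a))" by simp
    then show ?thesis using bb by (simp add: u_def)
  qed
  then have c': "c = (1 - u) *\<^sub>R a + u *\<^sub>R b" by (simp add: algebra_simps)
  have "u \<noteq> 0" "u \<noteq> 1" using c' ne by auto
  then consider "u < 0" | "0 < u \<and> u < 1" | "1 < u" by linarith
  then show False
  proof cases
    case 1
    define v where "v = 1 / (1 - u)"
    have v: "0 < v" "v < 1" using 1 by (simp_all add: v_def)
    have "v *\<^sub>R c + (1 - v) *\<^sub>R b = (v * (1 - u)) *\<^sub>R a + (v * u + (1 - v)) *\<^sub>R b"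
      unfolding c' by (simp add: algebra_simps)
    also have "v * (1 - u) = 1" using 1 by (simp add: v_def)
    also have "v * u + (1 - v) = 0" using 1 by (simp add: v_def field_simps)
    finally show False using no[of a b c v] abc ne v by (simp add: add.commute)
  next
    case 2
    then show False using no[of c a b u] abc ne c' by blast
  next
    case 3
    define v where "v = 1 / u"
    have v: "0 < v" "v < 1" using 3 by (simp_all add: v_def)
    have "v *\<^sub>R c + (1 - v) *\<^sub>R a = (v * (1 - u) + (1 - v)) *\<^sub>R a + (v * u) *\<^sub>R b"
      unfolding c' by (simp add: algebra_simps)
    also have "v * u = 1" using 3 by (simp add: v_def)
    also have "v * (1 - u) + (1 - v) = 0" using 3 by (simp add: v_def field_simps)
    finally show False using no[of b a c v] abc ne v by (simp add: add.commute)
  qed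
qed

text \<open>The signs place \<open>a\<close> inside the triangle \<open>b c e\<close>, with the
  three areas as barycentric coordinates. The line from \<open>b\<close> through \<open>a\<close>
  meets the side \<open>c e\<close> in \<open>q\<close>, so \<open>a\<close> is inside a segment of
  the hull.\<close>

lemma first_layer_not_in_triangle:
  assumes X: "finite X" and V: "a \<in> first_layer X" "b \<in> first_layer X" "c \<in> first_layer X" "e \<in> first_layer X"
    and pos: "orient a b c > 0" "orient a c e > 0" "orient a e b > 0"
  shows False
proof -
  have hull: "a extreme_point_of convex hull X" "b \<in> convex hull X" "c \<in> convex hull X" "e \<in> convex hull X"
    using V by (auto simp: first_layer_def extreme_point_of_def)
  define \<beta> \<gamma> \<epsilon> where "\<beta> = orient a c e" and "\<gamma> = orient a e b" and "\<epsilon> = orient a b c"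
  have p: "\<beta> > 0" "\<gamma> > 0" "\<epsilon> > 0" using pos by (simp_all add: \<beta>_def \<gamma>_def \<epsilon>_def)
  define q where "q = (\<gamma> / (\<gamma> + \<epsilon>)) *\<^sub>R c + (\<epsilon> / (\<gamma> + \<epsilon>)) *\<^sub>R e"
  define u where "u = (\<gamma> + \<epsilon>) / (\<beta> + \<gamma> + \<epsilon>)"
  have u: "0 < u" "u < 1" using p by (simp_all add: u_def)
  have q_hull: "q \<in> convex hull X"
    unfolding q_def using p by (intro convexD[OF convex_convex_hull hull(3,4)])
      (simp_all add: add_divide_distrib[symmetric])
  have "(\<beta> + \<gamma> + \<epsilon>) *\<^sub>R a = \<beta> *\<^sub>R b + \<gamma> *\<^sub>R c + \<epsilon> *\<^sub>R e"
    by (simp add: vec2_eq_iff \<beta>_def \<gamma>_def \<epsilon>_def orient_def cross2_def algebra_simps)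
  also have "\<dots> = \<beta> *\<^sub>R b + (\<gamma> + \<epsilon>) *\<^sub>R q"
    using p by (simp add: q_def scaleR_add_right)
  finally have "(1 / (\<beta> + \<gamma> + \<epsilon>)) *\<^sub>R ((\<beta> + \<gamma> + \<epsilon>) *\<^sub>R a)
    = (1 / (\<beta> + \<gamma> + \<epsilon>)) *\<^sub>R (\<beta> *\<^sub>R b + (\<gamma> + \<epsilon>) *\<^sub>R q)" by simp
  moreover have "1 - u = \<beta> / (\<beta> + \<gamma> + \<epsilon>)" using p by (simp add: u_def field_simps)
  ultimately have a: "a = (1 - u) *\<^sub>R b + u *\<^sub>R q"
    using p by (simp add: u_def scaleR_add_right)
  then have "b = q"
    using extreme_point_endpoints[OF hull(1) convex_convex_hull hull(2) q_hull u] by blast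
  then have "a = b" using a by (simp add: algebra_simps)
  then show False using pos by (simp add: orient_def cross2_def)
qed

lemma first_layer_orient_trans:
  assumes X: "finite X" and V: "a \<in> first_layer X" "b \<in> first_layer X" "c \<in> first_layer X" "e \<in> first_layer X"
    and pos: "orient a b c > 0" "orient a c e > 0"
  shows "orient a b e > 0"
proof (rule ccontr)
  assume neg: "\<not> orient a b e > 0"
  have "a \<noteq> b" "a \<noteq> e" "b \<noteq> e"
    using pos orient_skew[of a b c] by (auto simp: orient_def)
  then have "orient a b e < 0"
    using first_layer_orient_nonzero[OF X V(1,2,4)] neg by force
  then show False
    using first_layer_not_in_triangle[OF X V pos] by (simp add: orient_skew[of a e b])
qed

section \<open>The two largest distances\<close>

text \<open>Only the gap below the largest distance is recorded, in \<open>dist_cases\<close>;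
  \<open>w\<close> stands for a point outside the first two layers.\<close>

locale second_distance =
  fixes X :: "(real ^ 2) set" and d D :: real and w :: "real ^ 2"
  assumes finite_X: "finite X" and d_pos: "0 < d" and d_less: "d < D"
    and dist_cases: "x \<in> X \<Longrightarrow> y \<in> X \<Longrightarrow> dist x y \<le> d \<or> dist x y = D"
    and w_close: "x \<in> X \<Longrightarrow> dist w x < d"
begin

text \<open>The parameter \<open>V\<close> allows the same graph on the outer layer and on the union
  of both layers.\<close>

definition adj :: "(real ^ 2) set \<Rightarrow> real ^ 2 \<Rightarrow> real ^ 2 \<Rightarrow> bool" where
  "adj V x y \<longleftrightarrow> x \<in> V \<and> y \<in> V \<and> dist x y = d"

lemma inner_adj: "dist x y = d \<Longrightarrow> (y - x) \<bullet> (y - x) = d\<^sup>2"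
  using dist_eq_iff_inner[of d y x] d_pos by (simp add: dist_commute)

text \<open>Law of cosines: \<open>w\<close> is closer to \<open>y\<close> than \<open>x\<close> is,
  so the angle at \<open>x\<close> is acute.\<close>

lemma halfplane:
  assumes "y \<in> X" "dist x y = d" shows "(w - x) \<bullet> (y - x) > 0"
proof -
  have "\<not> (w - y) \<bullet> (w - y) = d\<^sup>2" "(w - y) \<bullet> (w - y) \<le> d\<^sup>2"
    using w_close[OF assms(1)] dist_eq_iff_inner[of d w y] dist_le_iff_inner[of d w y] d_pos by auto
  moreover have "(w - y) \<bullet> (w - y)
    = (w - x) \<bullet> (w - x) - 2 * ((w - x) \<bullet> (y - x)) + (y - x) \<bullet> (y - x)"
    by (simp add: algebra_simps inner_commute)
  ultimately show ?thesis using inner_adj[OF assms(2)] inner_ge_zero[of "w - x"] by linarith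
qed

lemma orient_trans_adj:
  assumes "y1 \<in> X" "y2 \<in> X" "y3 \<in> X" "dist x y1 = d" "dist x y2 = d" "dist x y3 = d"
    and "orient x y1 y2 > 0" "orient x y2 y3 > 0"
  shows "orient x y1 y3 > 0"
  using cross2_trans_halfplane[of "w - x" "y1 - x" "y2 - x" "y3 - x"] halfplane assms
  by (simp add: orient_def)

lemma orient_total_adj:
  assumes "y1 \<in> X" "y2 \<in> X" "dist x y1 = d" "dist x y2 = d" "y1 \<noteq> y2"
  shows "orient x y1 y2 > 0 \<or> orient x y2 y1 > 0"
proof -
  have "orient x y1 y2 \<noteq> 0"
    using cross2_eq_0_halfplane[OF halfplane[OF assms(1,3)] halfplane[OF assms(2,4)]]
      inner_adj[OF assms(3)] inner_adj[OF assms(4)] assms(5) by (auto simp: orient_def)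
  then show ?thesis using orient_skew[of x y1 y2] by linarith
qed

lemma dist_less_iff_inner:
  assumes "dist x y = d" "dist x z = d" "dist x y' = d" "dist x z' = d"
  shows "dist y z < dist y' z' \<longleftrightarrow> (y' - x) \<bullet> (z' - x) < (y - x) \<bullet> (z - x)"
proof -
  have *: "(dist y z)\<^sup>2 = 2 * d\<^sup>2 - 2 * ((y - x) \<bullet> (z - x))" if "dist x y = d" "dist x z = d" for y z
  proof -
    have "(dist y z)\<^sup>2 = ((y - x) - (z - x)) \<bullet> ((y - x) - (z - x))"
      by (simp add: dist_norm dot_square_norm)
    also have "\<dots> = (y - x) \<bullet> (y - x) + (z - x) \<bullet> (z - x) - 2 * ((y - x) \<bullet> (z - x))"
      by (simp only: inner_diff_left inner_diff_right inner_commute) simp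
    finally show ?thesis using inner_adj[OF that(1)] inner_adj[OF that(2)] by simp
  qed
  have "dist y z < dist y' z' \<longleftrightarrow> (dist y z)\<^sup>2 < (dist y' z')\<^sup>2"
    by (metis abs_le_square_iff abs_of_nonneg not_less zero_le_dist)
  then show ?thesis using *[OF assms(1,2)] *[OF assms(3,4)] by simp
qed

text \<open>On the circle around \<open>x\<close> the outer pair is further apart than the
  consecutive pairs. Its distance is at most \<open>D\<close>, so theirs are at most
  \<open>d\<close>, which bounds the angles by 60 degrees.\<close>

lemma consecutive_close:
  assumes X: "y1 \<in> X" "y2 \<in> X" "y3 \<in> X" and d: "dist x y1 = d" "dist x y2 = d" "dist x y3 = d"
    and or: "orient x y1 y2 > 0" "orient x y2 y3 > 0"
  shows "2 * ((y1 - x) \<bullet> (y2 - x)) \<ge> d\<^sup>2" "2 * ((y2 - x) \<bullet> (y3 - x)) \<ge> d\<^sup>2"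
proof -
  have "orient x y1 y3 > 0" using orient_trans_adj[OF X d or] .
  then have "dist y1 y2 < dist y1 y3" "dist y2 y3 < dist y1 y3"
    using inner2_antimono[OF inner_adj[OF d(1)] inner_adj[OF d(2)] inner_adj[OF d(3)]]
      or dist_less_iff_inner[OF d(1,2) d(1,3)] dist_less_iff_inner[OF d(2,3) d(1,3)]
    by (simp_all add: orient_def)
  moreover have "dist y1 y3 \<le> D" using dist_cases[OF X(1,3)] d_less by linarith
  ultimately have "dist y1 y2 \<le> d" "dist y2 y3 \<le> d"
    using dist_cases[OF X(1,2)] dist_cases[OF X(2,3)] by linarith+
  moreover have "2 * ((y - x) \<bullet> (z - x)) \<ge> d\<^sup>2" if "dist y z \<le> d" "dist x y = d" "dist x z = d" for y z
  proof -
    have "(y - z) \<bullet> (y - z) \<le> d\<^sup>2" using that dist_le_iff_inner[of d y z] d_pos by simp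
    moreover have "(y - z) \<bullet> (y - z) = (y - x) \<bullet> (y - x) + (z - x) \<bullet> (z - x) - 2 * ((y - x) \<bullet> (z - x))"
      by (simp add: algebra_simps inner_commute)
    ultimately show ?thesis using inner_adj[OF that(2)] inner_adj[OF that(3)] by simp
  qed
  ultimately show "2 * ((y1 - x) \<bullet> (y2 - x)) \<ge> d\<^sup>2" "2 * ((y2 - x) \<bullet> (y3 - x)) \<ge> d\<^sup>2"
    using d by blast+
qed

text \<open>By \<open>zigzag_long\<close> both \<open>a\<close> and \<open>b\<close> are at distance
  \<open>D\<close> from \<open>c\<close>. Were they distinct, \<open>consecutive_close\<close> would
  supply the angle bounds with which \<open>zigzag_unique\<close> separates these distances.\<close>

lemma right_unique:
  assumes X: "x \<in> X" "y \<in> X" "a \<in> X" "b \<in> X" "c \<in> X"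
    and d: "dist x y = d" "dist x a = d" "dist x b = d" "dist y c = d"
    and or: "orient x a y > 0" "orient x b y > 0" "orient y c x > 0"
  shows "a = b"
proof -
  have diff: "(y - x) - (y - c) - (e - x) = c - e" for e by simp
  have cr: "cross2 (y - c) (y - x) > 0"
    using or(3) by (simp add: orient_def cross2_def algebra_simps)
  have D: "(c - e) \<bullet> (c - e) = D\<^sup>2" if "e \<in> X" "dist x e = d" "orient x e y > 0" for e
  proof -
    have "(y - x - (y - c) - (e - x)) \<bullet> (y - x - (y - c) - (e - x)) > d\<^sup>2"
      using that cr d by (intro zigzag_long) (auto simp: inner_adj orient_def dist_commute)
    then have "\<not> dist c e \<le> d"
      unfolding diff using dist_le_iff_inner[of d c e] d_pos by simp
    then have "dist c e = D" using dist_cases[OF X(5) that(1)] by blast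
    then show ?thesis using dist_eq_iff_inner[of D c e] d_pos d_less by simp
  qed
  have no: "\<not> orient x a b > 0"
    if "a \<in> X" "b \<in> X" "dist x a = d" "dist x b = d" "orient x a y > 0" "orient x b y > 0" for a b
  proof
    assume ab: "orient x a b > 0"
    have "2 * ((a - x) \<bullet> (b - x)) \<ge> d\<^sup>2" "2 * ((b - x) \<bullet> (y - x)) \<ge> d\<^sup>2"
      using consecutive_close[of a b y x] that ab X d by auto
    then have "(y - x - (y - c) - (a - x)) \<bullet> (y - x - (y - c) - (a - x))
      \<noteq> (y - x - (y - c) - (b - x)) \<bullet> (y - x - (y - c) - (b - x))"
      using that ab cr d
      by (intro zigzag_unique) (auto simp: inner_adj orient_def dist_commute)
    then show False unfolding diff using D that by simp
  qed
  show ?thesis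
    using no[OF X(3,4) d(2,3) or(1,2)] no[OF X(4,3) d(3,2) or(2,1)]
      orient_total_adj[OF X(3,4) d(2,3)] by blast
qed

lemma right_order_adj:
  assumes V: "V \<subseteq> X"
  shows "right_order V (adj V) (\<lambda>x a b. orient x a b > 0)"
proof
  show "finite V" using V finite_X finite_subset by blast
next
  fix x y assume "adj V x y"
  then show "x \<in> V" "adj V y x" by (auto simp: adj_def dist_commute)
next
  fix x a b assume *: "adj V x a" "adj V x b"
  show "\<not> orient x b a > 0" if "orient x a b > 0" using that orient_skew[of x a b] by simp
  show "orient x a b > 0 \<or> orient x b a > 0" if "a \<noteq> b"
    using orient_total_adj[of a b x] * that V by (auto simp: adj_def)
  fix c assume "adj V x c" "orient x a b > 0" "orient x b c > 0"
  then show "orient x a c > 0" using orient_trans_adj[of a b c x] * V by (auto simp: adj_def)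
next
  fix x y a b c assume "adj V x y" "adj V x a" "adj V x b" "adj V y c"
    "orient x a y > 0" "orient x b y > 0" "orient y c x > 0"
  then show "a = b" using right_unique[of x y a b c] V by (auto simp: adj_def)
qed

text \<open>With three neighbours and \<open>u\<close> the middle one, some \<open>v\<close> in
  \<open>S\<close> does not lie on the side of \<open>x\<close> towards \<open>u\<close>. This
  \<open>v\<close> serves as the point \<open>p\<close> of
  \<open>degree_three_impossible\<close>.\<close>

lemma degree_le_2:
  assumes S: "S \<subseteq> X" "x \<in> convex hull S" "x \<notin> S"
  shows "card {y \<in> X. dist x y = d} \<le> 2"
proof (rule ccontr)
  assume "\<not> ?thesis"
  then obtain T where T: "T \<subseteq> {y \<in> X. dist x y = d}" "card T = 3"
    by (metis obtain_subset_with_card_n[of 3] not_le Suc_leI eval_nat_numeral(3))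
  then obtain y1 y2 y3 where y: "T = {y1, y2, y3}" "y1 \<noteq> y2" "y2 \<noteq> y3" "y1 \<noteq> y3"
    by (auto simp: card_3_iff)
  have no: False
    if X: "a \<in> X" "u \<in> X" "b \<in> X" and d: "dist x a = d" "dist x u = d" "dist x b = d"
      and or: "orient x a u > 0" "orient x u b > 0" for a u b
  proof -
    have "\<exists>v\<in>S. (u - x) \<bullet> v \<le> (u - x) \<bullet> x"
    proof (rule ccontr)
      assume "\<not> ?thesis"
      then have "S \<subseteq> {z. (u - x) \<bullet> z > (u - x) \<bullet> x}" by auto
      then have "convex hull S \<subseteq> {z. (u - x) \<bullet> z > (u - x) \<bullet> x}"
        by (intro hull_minimal convex_halfspace_gt)
      then show False using S(2) by auto
    qed
    then obtain v where v: "v \<in> S" "(u - x) \<bullet> v \<le> (u - x) \<bullet> x" by blast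
    define p where "p = v - x"
    have p: "p \<bullet> (u - x) \<le> 0" "p \<noteq> 0"
      using v S(3) by (auto simp: p_def inner_commute inner_diff_right)
    \<comment> \<open>A neighbour in no acute direction from \<open>p\<close> is further than
      \<open>d\<close> from \<open>v\<close>, hence at distance \<open>D\<close>, which fixes the
      inner product.\<close>
    have far: "p \<bullet> (y - x) = (p \<bullet> p + d\<^sup>2 - D\<^sup>2) / 2"
      if "y \<in> X" "dist x y = d" "p \<bullet> (y - x) \<le> 0" for y
    proof -
      have *: "(v - y) \<bullet> (v - y) = p \<bullet> p - 2 * (p \<bullet> (y - x)) + d\<^sup>2"
      proof -
        have "v - y = p - (y - x)" by (simp add: p_def)
        then have "(v - y) \<bullet> (v - y) = (p - (y - x)) \<bullet> (p - (y - x))" by (simp only:)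
        also have "\<dots> = p \<bullet> p - 2 * (p \<bullet> (y - x)) + (y - x) \<bullet> (y - x)"
          by (simp only: inner_diff_left[of p] inner_diff_right[of _ p] inner_commute[of "y - x" p])
        finally show ?thesis using inner_adj[OF that(2)] by simp
      qed
      have "p \<bullet> p > 0" using p by simp
      then have "\<not> dist v y \<le> d"
        using * that(3) dist_le_iff_inner[of d v y] d_pos by linarith
      then have "dist v y = D" using dist_cases[of v y] v S(1) that(1) by blast
      then have "(v - y) \<bullet> (v - y) = D\<^sup>2" using dist_eq_iff_inner[of D v y] d_pos d_less by simp
      then show ?thesis using * by simp
    qed
    show False
      using degree_three_impossible[OF inner_adj[OF d(1)] inner_adj[OF d(3)] inner_adj[OF d(2)]
          or[unfolded orient_def] consecutive_close[OF X d or] p]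
        far X d by blast
  qed
  have *: "y1 \<in> X" "y2 \<in> X" "y3 \<in> X" "dist x y1 = d" "dist x y2 = d" "dist x y3 = d"
    using T y by auto
  have total: "orient x y1 y2 > 0 \<or> orient x y2 y1 > 0" "orient x y2 y3 > 0 \<or> orient x y3 y2 > 0"
    "orient x y1 y3 > 0 \<or> orient x y3 y1 > 0"
    using orient_total_adj * y by blast+
  show False
    using total no[OF *(1,2,3) *(4,5,6)] no[OF *(1,3,2) *(4,6,5)] no[OF *(2,1,3) *(5,4,6)]
      no[OF *(2,3,1) *(5,6,4)] no[OF *(3,1,2) *(6,4,5)] no[OF *(3,2,1) *(6,5,4)] by blast
qed

lemma convex_distance_graph_first_layer:
  defines "V \<equiv> first_layer X"
  shows "convex_distance_graph V (adj V) (\<lambda>a b c. orient a b c > 0)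
    (\<lambda>x y. x \<in> V \<and> y \<in> V \<and> dist x y = D)"
proof -
  have VX: "V \<subseteq> X" using first_layer_subset finite_X by (simp add: V_def)
  interpret right_order V "adj V" "\<lambda>x a b. orient x a b > 0"
    using VX by (rule right_order_adj)
  note trans = first_layer_orient_trans[OF finite_X, folded V_def]
  have quad: "dist a b + dist c e < dist a c + dist b e" "a \<in> V" "b \<in> V" "c \<in> V" "e \<in> V"
    "dist a c \<le> d \<or> dist a c = D" "dist b e \<le> d \<or> dist b e = D"
    if "orient a b c > 0" "orient a c e > 0" "a \<in> V" "b \<in> V" "c \<in> V" "e \<in> V" for a b c e
  proof -
    have "orient a b e > 0" using trans that by blast
    moreover have "orient c e b > 0"
      using trans[of c e a b] that by (metis orient_rotate)
    then have "orient b c e > 0" by (metis orient_rotate)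
    ultimately show "dist a b + dist c e < dist a c + dist b e"
      using dist_diagonals_gt that by blast
    show "dist a c \<le> d \<or> dist a c = D" "dist b e \<le> d \<or> dist b e = D"
      using dist_cases VX that by blast+
  qed (use that in auto)
  show ?thesis
  proof
    fix x y assume "x \<in> V \<and> y \<in> V \<and> dist x y = D"
    then show "x \<in> V" "y \<in> V \<and> x \<in> V \<and> dist y x = D" by (auto simp: dist_commute)
  next
    fix x show "\<not> (x \<in> V \<and> x \<in> V \<and> dist x x = D)" using d_pos d_less by simp
  next
    fix x y assume "adj V x y"
    then show "\<not> (x \<in> V \<and> y \<in> V \<and> dist x y = D)" using d_less by (simp add: adj_def)
  next
    fix a b c assume "orient a b c > 0"
    then show "orient b c a > 0" "\<not> orient a c b > 0"
      using orient_rotate[of b c a] orient_skew[of a b c] by auto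
  next
    fix a b c assume *: "a \<in> V" "b \<in> V" "c \<in> V" "a \<noteq> b" "a \<noteq> c" "b \<noteq> c"
    then have "orient a b c \<noteq> 0"
      using first_layer_orient_nonzero[OF finite_X] by (simp add: V_def)
    then show "orient a b c > 0 \<or> orient a c b > 0" using orient_skew[of a b c] by linarith
  next
    fix a b c e assume "a \<in> V" "b \<in> V" "c \<in> V" "e \<in> V" "orient a b c > 0" "orient a c e > 0"
    then show "orient a b e > 0" using trans by blast
  next
    \<comment> \<open>The diagonals sum to more than 2d, D + d or 2D respectively, while each is at
      most \<open>d\<close> or equal to \<open>D\<close>.\<close>
    fix a b c e assume or: "orient a b c > 0" "orient a c e > 0"
    show "(a \<in> V \<and> c \<in> V \<and> dist a c = D) \<or> (b \<in> V \<and> e \<in> V \<and> dist b e = D)"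
      if "adj V a b" "adj V c e"
      using quad[OF or] that unfolding adj_def by fastforce
    show "(a \<in> V \<and> c \<in> V \<and> dist a c = D) \<and> (b \<in> V \<and> e \<in> V \<and> dist b e = D)"
      if "a \<in> V \<and> b \<in> V \<and> dist a b = D" "adj V c e"
      using quad[OF or] that d_less unfolding adj_def by fastforce
    show "\<not> (c \<in> V \<and> e \<in> V \<and> dist c e = D)" if "a \<in> V \<and> b \<in> V \<and> dist a b = D"
      using quad[OF or] that d_less by fastforce
  next
    fix p a q r b s
    assume or: "orient p a q > 0" "orient p q r > 0" "orient p r b > 0" "orient p b s > 0"
      and adj: "adj V p s" "adj V q r" and diam: "p \<in> V \<and> r \<in> V \<and> dist p r = D" "q \<in> V \<and> s \<in> V \<and> dist q s = D"
      and mid: "adj V a r" "adj V a s" "adj V b p"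
    show "\<not> adj V b q"
    proof
      assume bq: "adj V b q"
      have V: "p \<in> V" "a \<in> V" "q \<in> V" "r \<in> V" "b \<in> V" "s \<in> V"
        using adj mid by (auto simp: adj_def)
      have prs: "orient p r s > 0" using trans[of p r b s] or V by blast
      have pqs: "orient p q s > 0" using trans[of p q r s] or prs V by blast
      have "orient b s p > 0" "orient b p r > 0"
        using or(3,4) by (metis orient_rotate)+
      then have "orient b s r > 0" using trans V by blast
      then have srb: "orient s r b > 0" by (metis orient_rotate)
      have diag: "(r - p) \<bullet> (r - p) = (s - q) \<bullet> (s - q)"
        using diam dist_eq_iff_inner[of D r p] dist_eq_iff_inner[of D s q] d_pos d_less
        by (simp add: dist_commute)
      \<comment> \<open>The trapezoid is translated to put \<open>p\<close> at the origin; these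
        identities restore the original differences.\<close>
      have eqs: "s - p + (r - s) = r - p" "r - p - (q - p) = r - q" "s - p - (q - p) = s - q"
        "r - p - (a - p) = r - a" "s - p - (a - p) = s - a" "b - p - (q - p) = b - q"
        "b - p - (s - p) = b - s" by simp_all
      have "cross2 (r - s) (s - p) > 0"
        using prs by (simp add: orient_def cross2_def algebra_simps)
      then show False
        using trapezoid_impossible[of "s - p" "d\<^sup>2" "r - s" "q - p" "a - p" "b - p", unfolded eqs]
          adj mid bq diag or[unfolded orient_def] pqs[unfolded orient_def] srb[unfolded orient_def]
          inner_adj[of p s] inner_adj[of q r] inner_adj[of a r] inner_adj[of a s]
          inner_adj[of p b] inner_adj[of q b]
        by (simp add: adj_def dist_commute)
    qed
  qed
qed

end

section \<open>Multiplicity of the second largest distance\<close>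

text \<open>Each unordered pair has two orderings; letting \<open>P\<close> act on the set builds in
  the symmetry.\<close>

lemma card_ordered_pairs:
  assumes "finite X"
  shows "card {(x, y). x \<in> X \<and> y \<in> X \<and> x \<noteq> y \<and> P {x, y}}
    = 2 * card {{x, y} |x y. x \<in> X \<and> y \<in> X \<and> x \<noteq> y \<and> P {x, y}}"
    (is "card ?A = 2 * card ?E")
proof -
  let ?g = "\<lambda>(x, y). {x, y}"
  have fin: "finite ?A" by (rule finite_subset[of _ "X \<times> X"]) (use assms in auto)
  have img: "?g ` ?A = ?E" by (auto simp: image_iff)
  have finE: "finite ?E" using finite_imageI[OF fin, of ?g] unfolding img .
  have "card ?A = (\<Sum>e\<in>?E. \<Sum>p\<in>{p \<in> ?A. ?g p = e}. 1)"
    using sum.group[OF fin finE, of ?g "\<lambda>_. 1 :: nat"] img by simp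
  also have "\<dots> = (\<Sum>e\<in>?E. 2)"
  proof (rule sum.cong[OF refl])
    fix e assume "e \<in> ?E"
    then obtain x y where e: "e = {x, y}" "x \<in> X" "y \<in> X" "x \<noteq> y" "P {x, y}" by blast
    moreover have "P {y, x}" using e by (simp add: insert_commute)
    ultimately have "{p \<in> ?A. ?g p = e} = {(x, y), (y, x)}"
      by (auto simp: doubleton_eq_iff)
    then show "(\<Sum>p\<in>{p \<in> ?A. ?g p = e}. 1) = (2 :: nat)" using e by simp
  qed
  finally show ?thesis by simp
qed

lemma multiplicity_of_distance_eq:
  assumes "finite X" "d > 0"
  shows "2 * multiplicity_of_distance X d = card {(x, y). x \<in> X \<and> y \<in> X \<and> dist x y = d}"
proof -
  define P where "P e \<longleftrightarrow> (\<exists>x y. e = {x, y} \<and> dist x y = d)" for e :: "(real ^ 2) set"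
  have P: "P {x, y} \<longleftrightarrow> dist x y = d" for x y
    unfolding P_def by (metis dist_commute doubleton_eq_iff)
  have "{(x, y). x \<in> X \<and> y \<in> X \<and> dist x y = d} = {(x, y). x \<in> X \<and> y \<in> X \<and> x \<noteq> y \<and> dist x y = d}"
    using assms(2) by auto
  then show ?thesis
    using card_ordered_pairs[OF assms(1), of P] unfolding P multiplicity_of_distance_def by simp
qed

lemma second_largest_distanceD:
  assumes "finite X" "is_second_largest_distance X d"
  obtains D where "0 < d" "d < D" "\<And>x y. x \<in> X \<Longrightarrow> y \<in> X \<Longrightarrow> dist x y \<le> d \<or> dist x y = D"
proof -
  let ?D = "Max (distances X)"
  have "distances X \<subseteq> case_prod dist ` (X \<times> X)"
  proof
    fix r assume "r \<in> distances X"
    then obtain x y where "x \<in> X" "y \<in> X" "r = dist x y" by (auto simp: distances_def)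
    then show "r \<in> case_prod dist ` (X \<times> X)" by (intro image_eqI[of _ _ "(x, y)"]) auto
  qed
  then have fin: "finite (distances X)"
    using assms(1) by (rule finite_subset[OF _ finite_imageI[OF finite_cartesian_product]]) (rule assms(1))
  then have d: "d \<in> distances X" "d \<noteq> ?D"
    using assms(2) Max_in[of "distances X - {?D}"] by (auto simp: is_second_largest_distance_def)
  have pos: "0 < d" using d(1) by (auto simp: distances_def)
  show thesis
  proof (rule that[of ?D])
    show "0 < d" by fact
    show "d < ?D" using Max_ge[OF fin d(1)] d(2) by linarith
    fix x y assume xy: "x \<in> X" "y \<in> X"
    show "dist x y \<le> d \<or> dist x y = ?D"
    proof (cases "x = y \<or> dist x y = ?D")
      case False
      then have "dist x y \<in> distances X - {?D}" using xy by (auto simp: distances_def)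
      then have "dist x y \<le> Max (distances X - {?D})" using fin by simp
      then show ?thesis using assms(2) by (simp add: is_second_largest_distance_def)
    qed (use pos in auto)
  qed
qed

text \<open>Ends of a pair at distance \<open>D\<close> are extreme, since otherwise an extreme
  point would be further away. Replacing a non-extreme \<open>x\<close> by a point further from
  \<open>y\<close> reaches distance \<open>D\<close>, so \<open>y\<close> is extreme; were
  \<open>x\<close> outside the second layer too, the replacement could be chosen non-extreme, a
  contradiction.\<close>

lemma distance_edge_layers:
  assumes X: "finite X" and d: "d < D" "\<And>x y. x \<in> X \<Longrightarrow> y \<in> X \<Longrightarrow> dist x y \<le> d \<or> dist x y = D"
    and xy: "x \<in> X" "y \<in> X" "d \<le> dist x y" and x: "x \<notin> first_layer X"
  shows "y \<in> first_layer X" and "x \<in> second_layer X"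
proof -
  have D: "dist a b \<le> D" if "a \<in> X" "b \<in> X" for a b
    using d(2)[OF that] d(1) by linarith
  have out: "b \<in> first_layer X" if ab: "a \<in> X" "b \<in> X" "dist a b = D" for a b
  proof (rule ccontr)
    assume "b \<notin> first_layer X"
    then obtain v where "v \<in> first_layer X" "dist b a < dist v a"
      using not_first_layer_further[OF X ab(2)] by blast
    then show False
      using D[of v a] first_layer_subset[OF X] ab by (auto simp: dist_commute)
  qed
  obtain v where v: "v \<in> first_layer X" "dist x y < dist v y"
    using not_first_layer_further[OF X xy(1) x] by blast
  have vX: "v \<in> X" using v first_layer_subset[OF X] by blast
  have "dist v y = D" using d(2)[OF vX xy(2)] v xy by linarith
  then show y: "y \<in> first_layer X" using out vX xy by blast
  show "x \<in> second_layer X"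
  proof (rule ccontr)
    let ?Y = "X - first_layer X"
    assume "x \<notin> second_layer X"
    then have "x \<notin> first_layer ?Y" by (simp add: second_layer_def)
    then obtain u where u: "u \<in> first_layer ?Y" "dist x y < dist u y"
      using not_first_layer_further[of ?Y x y] X xy x by blast
    then have "u \<in> X" "u \<notin> first_layer X" using first_layer_subset[of ?Y] X by auto
    moreover from this have "dist u y = D" using d(2)[of u y] u(2) xy by linarith
    ultimately show False using out[of y u] xy by (simp add: dist_commute)
  qed
qed

theorem theorem1p3:
  fixes X :: "(real ^ 2) set" and n :: nat and d :: real
  assumes "finite X" and "card X = n" and "n \<ge> 2"
    and "Min {3 / 2 * (real (card (first_layer X)) + real (card (second_layer X))),
              4 / 3 * real (card (first_layer X)) + 2 * real (card (second_layer X)),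
              2 * real (card (first_layer X)) + real (card (second_layer X))} \<le> real n"
    and "is_second_largest_distance X d"
  shows "multiplicity_of_distance X d \<le> n"
proof -
  obtain D where d_pos: "0 < d" and d_less: "d < D"
    and dist_cases: "\<And>x y. x \<in> X \<Longrightarrow> y \<in> X \<Longrightarrow> dist x y \<le> d \<or> dist x y = D"
    using second_largest_distanceD[OF assms(1,5)] by blast
  have edge: "y \<in> first_layer X" "x \<in> second_layer X"
    if "x \<in> X" "y \<in> X" "d \<le> dist x y" "x \<notin> first_layer X" for x y
    using distance_edge_layers[of X d D x y] assms(1) d_less dist_cases that by blast+
  define V1 V2 where "V1 = first_layer X" and "V2 = second_layer X"
  define V where "V = V1 \<union> V2"
  have V1: "V1 \<subseteq> X" "finite V1" and V2: "V2 \<subseteq> X - V1" "finite V2"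
    using first_layer_subset[of X] first_layer_subset[of "X - first_layer X"] assms(1)
    by (auto simp: V1_def V2_def second_layer_def intro: finite_subset)
  have V: "V \<subseteq> X" "finite V" using V1 V2 by (auto simp: V_def)
  have card_V: "card V = card V1 + card V2"
    unfolding V_def using V1 V2 by (intro card_Un_disjoint) auto
  have V1_pos: "card V1 > 0"
  proof -
    have "X \<noteq> {}" using assms(2,3) by auto
    then show ?thesis using first_layer_nonempty[OF assms(1)] V1 by (auto simp: V1_def card_gt_0_iff)
  qed
  have min: "3 * (real (card V1) + real (card V2)) \<le> 2 * real n
    \<or> 4 * real (card V1) + 6 * real (card V2) \<le> 3 * real n
    \<or> 2 * real (card V1) + real (card V2) \<le> real n"
    using assms(4) by (auto simp: V1_def V2_def min_le_iff_disj field_simps)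
  moreover have "real (card V) = real (card V1) + real (card V2)" "real (card V1) > 0"
    "real (card V2) \<ge> 0"
    using card_V V1_pos by simp_all
  \<comment> \<open>Since the outer layer is nonempty, every term of the minimum exceeds the size of
    the two layers.\<close>
  ultimately have "real (card V) < real n" by auto
  then have "card V < card X" using assms(2) by simp
  then obtain w where w: "w \<in> X" "w \<notin> V"
    using card_mono[OF V(2), of X] by (meson not_le subsetI)
  \<comment> \<open>This is why \<open>edge\<close> covers all distances of at least
    \<open>d\<close>: any of them at \<open>w\<close> would put \<open>w\<close> into a
    layer.\<close>
  have w_close: "dist w x < d" if "x \<in> X" for x
    using edge(2)[OF w(1) that] w(2) by (force simp: V_def V1_def V2_def)
  interpret second_distance X d D w
    using assms(1) d_pos d_less dist_cases w_close by unfold_locales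
  define P where "P = {(x, y). x \<in> X \<and> y \<in> X \<and> dist x y = d}"
  have outside: "y \<in> V1 \<and> x \<in> V2" if "x \<in> X" "y \<in> X" "dist x y = d" "x \<notin> V1" for x y
    using edge[of x y] that by (simp add: V1_def V2_def)
  have layers: "x \<in> V" if "x \<in> X" "y \<in> X" "dist x y = d" for x y
    using outside[of x y] that by (auto simp: V_def)
  have cover: "x \<in> V1 \<or> y \<in> V1" if "adj V x y" for x y
    using outside[of x y] that V(1) by (auto simp: adj_def)
  have P: "P = {(x, y). adj V x y}"
    using layers V(1) unfolding P_def adj_def by (auto simp: dist_commute)
  interpret all: right_order V "adj V" "\<lambda>x a b. orient x a b > 0"
    using V(1) by (rule right_order_adj)
  interpret outer: convex_distance_graph V1 "adj V1" "\<lambda>a b c. orient a b c > 0"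
    "\<lambda>x y. x \<in> V1 \<and> y \<in> V1 \<and> dist x y = D"
    unfolding V1_def by (rule convex_distance_graph_first_layer)
  have le1: "card P \<le> 3 * (card V1 + card V2)"
    using all.card_adj_le_3 unfolding P card_V .
  have le2: "card P \<le> 4 * card V1 + 2 * card V2"
  proof -
    have "card P \<le> 2 * card V + 2 * card V1"
      unfolding P by (rule all.card_adj_le_vertex_cover) (use cover in \<open>auto simp: V_def\<close>)
    then show ?thesis using card_V by simp
  qed
  have le3: "3 * card P \<le> 8 * card V1 + 12 * card V2"
  proof -
    \<comment> \<open>Edges not inside the outer layer have an end in \<open>V2\<close>, of degree
      at most 2 because it lies in the hull of \<open>V1\<close>. With both orders they add at most
      \<open>4 * card V2\<close>.\<close>
    define Q where "Q = Sigma V2 (\<lambda>x. {y \<in> X. dist x y = d})"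
    have finQ: "finite Q" unfolding Q_def using V2 assms(1) by auto
    have "card {y \<in> X. dist x y = d} \<le> 2" if "x \<in> V2" for x
      using degree_le_2[OF V1(1), of x] that V2(1) hull_inc[of x X convex]
        convex_hull_first_layer[OF assms(1)] by (auto simp: V1_def)
    then have "(\<Sum>x\<in>V2. card {y \<in> X. dist x y = d}) \<le> 2 * card V2"
      using sum_bounded_above[of V2 "\<lambda>x. card {y \<in> X. dist x y = d}" 2] by simp
    then have Q: "card Q \<le> 2 * card V2"
      unfolding Q_def using V2 assms(1) by (subst card_SigmaI) auto
    have "P \<subseteq> {(x, y). adj V1 x y} \<union> (Q \<union> prod.swap ` Q)"
    proof
      fix e assume "e \<in> P"
      then obtain x y where e: "e = (x, y)" "x \<in> X" "y \<in> X" "dist x y = d" by (auto simp: P_def)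
      then have "adj V1 x y \<or> (x, y) \<in> Q \<or> (y, x) \<in> Q"
        using outside[of x y] outside[of y x] by (auto simp: Q_def adj_def dist_commute)
      then show "e \<in> {(x, y). adj V1 x y} \<union> (Q \<union> prod.swap ` Q)"
        using e(1) by (auto intro: image_eqI[of _ _ "(y, x)"])
    qed
    then have "card P \<le> card ({(x, y). adj V1 x y} \<union> (Q \<union> prod.swap ` Q))"
      using finQ outer.finite_adj by (intro card_mono) auto
    also have "\<dots> \<le> card {(x, y). adj V1 x y} + (card Q + card (prod.swap ` Q))"
      by (meson add_left_mono card_Un_le order_trans)
    also have "\<dots> \<le> card {(x, y). adj V1 x y} + 4 * card V2"
      using Q card_image_le[OF finQ, of prod.swap] by linarith
    finally show ?thesis using outer.card_adj_le_convex by linarith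
  qed
  have "2 * multiplicity_of_distance X d = card P"
    unfolding P_def using multiplicity_of_distance_eq[OF assms(1) d_pos] .
  then have "2 * real (multiplicity_of_distance X d) = real (card P)"
    by (metis of_nat_mult of_nat_numeral)
  \<comment> \<open>Halved, these three bounds are the terms of the minimum, so whichever term is at
    most \<open>n\<close> suffices.\<close>
  moreover have "real (card P) \<le> 3 * (real (card V1) + real (card V2))"
    "real (card P) \<le> 4 * real (card V1) + 2 * real (card V2)"
    "3 * real (card P) \<le> 8 * real (card V1) + 12 * real (card V2)"
    using of_nat_mono[OF le1, where 'a = real] of_nat_mono[OF le2, where 'a = real]
      of_nat_mono[OF le3, where 'a = real] by simp_all
  ultimately have "real (multiplicity_of_distance X d) \<le> real n"
    using min by argo
  then show ?thesis by simp
qed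

end
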